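(* Let $A$ be an integer matrix with $n$ columns such that $\operatorname{Ker}_{\mathbb Z}(A)\cap\mathbb N^n=\{\mathbf 0\}$ and the toric ideal $I_A$ has codimension $2$ (i.e. $A$ has rank $n-2$). The circuits of $I_A$ are all indispensable if and only if $I_A$ is robust.
   Context: $K$ is a field. $\operatorname{Ker}_{\mathbb Z}(A)=\{\mathbf u\in\mathbb Z^n: A\mathbf u=0\}$, and the toric ideal $I_A\subset K[x_1,\dots,x_n]$ is generated by the binomials $x^{\mathbf u^+}-x^{\mathbf u^-}$, $\mathbf u\in\operatorname{Ker}_{\mathbb Z}(A)$, where $\mathbf u=\mathbf u^+-\mathbf u^-$ with $\mathbf u^\pm\in\mathbb N^n$ of disjoint supports. A circuit of $I_A$ is an irreducible binomial $x^{\mathbf u^+}-x^{\mathbf u^-}$ with $\mathbf 0\ne\mathbf u\in\operatorname{Ker}_{\mathbb Z}(A)$ whose support (set of variables appearing in it) is minimal with respect to inclusion among the nonzero binomials of this form. A binomial of $I_A$ is indispensable if, up to sign, it belongs to every minimal system of binomial generators of $I_A$. The universal Gröbner basis of $I_A$ is the union of all its reduced Gröbner bases (binomials identified with their opposites). $I_A$ is robust if its universal Gröbner basis is a minimal generating set of $I_A$. *)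

theory Defs
  imports
    "HOL-Analysis.Analysis"
    "HOL-Library.Poly_Mapping"
    "HOL-Computational_Algebra.Factorial_Ring"
begin

type_synonym 'n expo = "'n \<Rightarrow>\<^sub>0 nat"
type_synonym ('n, 'k) mpoly = "'n expo \<Rightarrow>\<^sub>0 'k"

abbreviation monom :: "'n expo \<Rightarrow> ('n, 'k::comm_ring_1) mpoly" where
  "monom t \<equiv> Poly_Mapping.single t 1"

definition vars :: "('n, 'k::zero) mpoly \<Rightarrow> 'n set" where
  "vars f = (\<Union>t\<in>Poly_Mapping.keys f. Poly_Mapping.keys t)"

text \<open>The ideal generated by \<open>S\<close>: the span of \<open>S\<close> in the ring regarded as a module over itself.\<close>

lemma module_times: "module ((*) :: 'a::comm_ring_1 \<Rightarrow> 'a \<Rightarrow> 'a)"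
  by unfold_locales (simp_all add: algebra_simps)

definition ideal_gen :: "'a::comm_ring_1 set \<Rightarrow> 'a set" where
  "ideal_gen S = module.span (*) S"

definition minimal_generating_set :: "'a::comm_ring_1 set \<Rightarrow> 'a set \<Rightarrow> bool" where
  "minimal_generating_set I S \<longleftrightarrow> ideal_gen S = I \<and> (\<forall>T. T \<subset> S \<longrightarrow> ideal_gen T \<noteq> I)"


definition int_kernel :: "int ^ 'n ^ 'm \<Rightarrow> (int ^ 'n) set" where
  "int_kernel A = {u. A *v u = 0}"

text \<open>\<open>pos_part u\<close> is the exponent vector \<open>u\<^sup>+\<close>, and \<open>u\<^sup>- = (-u)\<^sup>+\<close>.\<close>

lift_definition pos_part :: "int ^ 'n::finite \<Rightarrow> 'n expo" is "\<lambda>u i. nat (u $ i)"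
  by simp

definition kernel_binomial :: "int ^ 'n::finite \<Rightarrow> ('n, 'k::comm_ring_1) mpoly" where
  "kernel_binomial u = monom (pos_part u) - monom (pos_part (- u))"

definition toric_ideal :: "int ^ 'n::finite ^ 'm \<Rightarrow> ('n, 'k::field) mpoly set" where
  "toric_ideal A = ideal_gen (kernel_binomial ` int_kernel A)"

definition circuits :: "int ^ 'n::finite ^ 'm \<Rightarrow> ('n, 'k::field) mpoly set" where
  "circuits A = {kernel_binomial u | u.
     u \<in> int_kernel A \<and> u \<noteq> 0 \<and>
     irreducible (kernel_binomial u :: ('n, 'k) mpoly) \<and>
     (\<forall>v \<in> int_kernel A. v \<noteq> 0 \<longrightarrow>
        \<not> vars (kernel_binomial v :: ('n, 'k) mpoly) \<subset> vars (kernel_binomial u :: ('n, 'k) mpoly))}"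


text \<open>As usual for toric ideals, a binomial is a difference of two monomials with coefficients
  \<open>1\<close> and \<open>-1\<close>; with arbitrary coefficients, belonging to a system of generators
  up to sign would not be meaningful.\<close>

definition is_binomial :: "('n, 'k::comm_ring_1) mpoly \<Rightarrow> bool" where
  "is_binomial f \<longleftrightarrow> (\<exists>s t. s \<noteq> t \<and> f = monom s - monom t)"

definition indispensable :: "('n, 'k::field) mpoly set \<Rightarrow> ('n, 'k) mpoly \<Rightarrow> bool" where
  "indispensable I f \<longleftrightarrow> is_binomial f \<and> f \<in> I \<and>
     (\<forall>S. minimal_generating_set I S \<and> (\<forall>g\<in>S. is_binomial g) \<longrightarrow> f \<in> S \<or> - f \<in> S)"


text \<open>Global (i.e. well-founded, with \<open>1\<close> the least monomial) monomial orders.\<close>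

definition monomial_order :: "('n expo \<Rightarrow> 'n expo \<Rightarrow> bool) \<Rightarrow> bool" where
  "monomial_order le \<longleftrightarrow>
     class.linorder le (\<lambda>s t. le s t \<and> s \<noteq> t) \<and>
     (\<forall>t. le 0 t) \<and>
     (\<forall>r s t. le s t \<longrightarrow> le (r + s) (r + t))"

definition lead_expo :: "('n expo \<Rightarrow> 'n expo \<Rightarrow> bool) \<Rightarrow> ('n, 'k::zero) mpoly \<Rightarrow> 'n expo" where
  "lead_expo le f = (THE t. t \<in> Poly_Mapping.keys f \<and> (\<forall>s \<in> Poly_Mapping.keys f. le s t))"

definition lead_monom ::
    "('n expo \<Rightarrow> 'n expo \<Rightarrow> bool) \<Rightarrow> ('n, 'k::comm_ring_1) mpoly \<Rightarrow> ('n, 'k) mpoly" where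
  "lead_monom le f = monom (lead_expo le f)"

definition initial_ideal ::
    "('n expo \<Rightarrow> 'n expo \<Rightarrow> bool) \<Rightarrow> ('n, 'k::field) mpoly set \<Rightarrow> ('n, 'k) mpoly set" where
  "initial_ideal le I = ideal_gen (lead_monom le ` (I - {0}))"

definition groebner_basis ::
    "('n expo \<Rightarrow> 'n expo \<Rightarrow> bool) \<Rightarrow> ('n, 'k::field) mpoly set \<Rightarrow> ('n, 'k) mpoly set \<Rightarrow> bool" where
  "groebner_basis le I G \<longleftrightarrow>
     finite G \<and> G \<subseteq> I \<and> ideal_gen (lead_monom le ` (G - {0})) = initial_ideal le I"

definition reduced_groebner_basis ::
    "('n expo \<Rightarrow> 'n expo \<Rightarrow> bool) \<Rightarrow> ('n, 'k::field) mpoly set \<Rightarrow> ('n, 'k) mpoly set \<Rightarrow> bool" where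
  "reduced_groebner_basis le I G \<longleftrightarrow>
     groebner_basis le I G \<and> 0 \<notin> G \<and>
     (\<forall>g\<in>G. Poly_Mapping.lookup g (lead_expo le g) = 1) \<and>
     (\<forall>g\<in>G. \<forall>h\<in>G. g \<noteq> h \<longrightarrow>
        (\<forall>t \<in> Poly_Mapping.keys h. \<not> lead_monom le g dvd (monom t :: ('n, 'k) mpoly)))"

text \<open>The elements of the universal Groebner basis are identified with their opposites, so it is
  rendered as a set of classes \<open>{g, -g}\<close>. A set of such classes generates the ideal generated by
  the members of its classes, and minimality refers to omitting whole classes.\<close>

definition universal_groebner_basis :: "('n, 'k::field) mpoly set \<Rightarrow> ('n, 'k) mpoly set set" where
  "universal_groebner_basis I =
     {{g, - g} | g. \<exists>le G. monomial_order le \<and> reduced_groebner_basis le I G \<and> g \<in> G}"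

definition robust :: "('n, 'k::field) mpoly set \<Rightarrow> bool" where
  "robust I \<longleftrightarrow>
     ideal_gen (\<Union>(universal_groebner_basis I)) = I \<and>
     (\<forall>C. C \<subset> universal_groebner_basis I \<longrightarrow> ideal_gen (\<Union>C) \<noteq> I)"

end

theory Submission
  imports Defs
begin

text \<open>
  Let \<open>L\<close> be the kernel of \<open>A\<close>. Everything is reduced to the fibres, the finite sets of exponents
  of the same \<open>A\<close>-degree: the binomial of \<open>u \<in> L\<close> is indispensable iff the fibre of \<open>u\<^sup>+\<close> is just
  \<open>{u\<^sup>+, u\<^sup>-}\<close> (\<open>indispensable_iff_thin\<close>). Call such \<open>u\<close> thin. For a monomial order, the least elements
  of the fibres are the standard monomials, and the reduced Groebner basis consists of the
  binomials \<open>x\<^bsup>a\<^esup> - x\<^bsup>b\<^esup>\<close>, where \<open>a\<close> is a minimal nonstandard exponent and \<open>b\<close> the least element of its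
  fibre. In particular the universal Groebner basis consists of binomials of Graver vectors.

  Robustness makes all circuits thin. The binomial of a circuit belongs to the
  universal Groebner basis, by an elimination order. If its fibre had a third element, then for a
  suitable weight neither of its monomials would be least in the fibre
  (\<open>order_avoiding_binomial\<close>); the reduced Groebner basis for this order would generate the ideal
  without the binomial, and the universal Groebner basis would not be minimal.

  Conversely, let all circuits be thin, and let \<open>L\<close> have rank \<open>2\<close>. It suffices that all Graver vectors
  \<open>z\<close> are thin, because a binomial with a two-element fibre cannot be omitted from a binomial system of
  generators (\<open>thin_in_generating_set\<close>). If \<open>z\<close> is not a circuit, then \<open>z = \<alpha>a + \<beta>b\<close> with circuits \<open>a\<close>
  and \<open>b\<close> in the orthant of \<open>z\<close> and \<open>\<alpha>, \<beta> \<ge> 0\<close>, and \<open>\<alpha> + \<beta> \<le> 1\<close> because Graver vectors do not lie beyond the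
  segment from \<open>a\<close> to \<open>b\<close> (\<open>graver_comb_le_1\<close>). Consequently \<open>z\<^sub>i \<le> max a\<^sub>i b\<^sub>i\<close> wherever \<open>z\<^sub>i > 0\<close>, and a
  planar argument shows that a third element of the fibre of \<open>z\<close> would produce one for \<open>a\<close> or for \<open>b\<close>
  (\<open>thin_comb\<close>).
\<close>


section \<open>Ideals and monomials\<close>

lemmas ideal_gen_base = module.span_base[OF module_times, folded ideal_gen_def]
lemmas ideal_gen_zero = module.span_zero[OF module_times, folded ideal_gen_def]
lemmas ideal_gen_add = module.span_add[OF module_times, folded ideal_gen_def]
lemmas ideal_gen_diff = module.span_diff[OF module_times, folded ideal_gen_def]
lemmas ideal_gen_neg = module.span_neg[OF module_times, folded ideal_gen_def]
lemmas ideal_gen_mult = module.span_scale[OF module_times, folded ideal_gen_def]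
lemmas ideal_gen_mono = module.span_mono[OF module_times, folded ideal_gen_def]

lemma ideal_gen_minimal:
  assumes "S \<subseteq> J" "0 \<in> J" "\<And>f g. f \<in> J \<Longrightarrow> g \<in> J \<Longrightarrow> f + g \<in> J"
    "\<And>r f. f \<in> J \<Longrightarrow> r * f \<in> J"
  shows "ideal_gen S \<subseteq> J"
  unfolding ideal_gen_def
  by (rule module.span_minimal[OF module_times])
    (use assms in \<open>auto simp: module.subspace_def[OF module_times]\<close>)

lemma ideal_gen_subset: "S \<subseteq> ideal_gen T \<Longrightarrow> ideal_gen S \<subseteq> ideal_gen T"
  by (rule ideal_gen_minimal) (auto intro: ideal_gen_zero ideal_gen_add ideal_gen_mult)

lemma poly_mapping_expansion:
  "f = (\<Sum>t\<in>Poly_Mapping.keys f. Poly_Mapping.single t (Poly_Mapping.lookup f t))"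
  by (rule poly_mapping_eqI)
    (auto simp: lookup_sum lookup_single when_def not_in_keys_iff_lookup_eq_zero)

lemma lookup_single_times:
  fixes f :: "('n, 'k::comm_ring_1) mpoly"
  shows "Poly_Mapping.lookup (Poly_Mapping.single a c * f) (a + t) = c * Poly_Mapping.lookup f t"
proof -
  have "Poly_Mapping.lookup (Poly_Mapping.single a c * f) (a + t) =
        (\<Sum>l. (c when a = l) * (\<Sum>q. Poly_Mapping.lookup f q when a + t = l + q))"
    by (simp add: lookup_mult lookup_single)
  also have "\<dots> = (\<Sum>l. c * (\<Sum>q. Poly_Mapping.lookup f q when a + t = l + q) when a = l)"
    by (simp add: when_mult)
  also have "\<dots> = c * (\<Sum>q. Poly_Mapping.lookup f q when t = q)"
    by simp
  finally show ?thesis by simp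
qed

lemma keys_single_times:
  fixes f :: "('n, 'k::comm_ring_1) mpoly"
  shows "Poly_Mapping.keys (Poly_Mapping.single a c * f) \<subseteq> (+) a ` Poly_Mapping.keys f"
  using keys_mult[of "Poly_Mapping.single a c" f] by (auto split: if_splits)

lemma keys_binomial:
  "s \<noteq> t \<Longrightarrow> Poly_Mapping.keys (monom s - monom t :: ('n, 'k::comm_ring_1) mpoly) = {s, t}"
  by (auto simp: in_keys_iff lookup_minus lookup_single when_def split: if_splits)

lemma monom_mult: "monom s * monom t = (monom (s + t) :: ('n, 'k::comm_ring_1) mpoly)"
  by (simp add: mult_single)

lemma monom_eq_iff [simp]: "(monom s :: ('n, 'k::comm_ring_1) mpoly) = monom t \<longleftrightarrow> s = t"
  by (metis keys_single one_neq_zero singleton_inject)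

lemma expo_add_eq_iff: "(\<exists>c. t = s + c) \<longleftrightarrow> (\<forall>i. Poly_Mapping.lookup s i \<le> Poly_Mapping.lookup t i)"
  for s t :: "'n expo"
proof
  assume le: "\<forall>i. Poly_Mapping.lookup s i \<le> Poly_Mapping.lookup t i"
  have "t = s + (t - s)"
    by (rule poly_mapping_eqI) (use le in \<open>simp add: lookup_add lookup_minus\<close>)
  then show "\<exists>c. t = s + c" ..
qed (auto simp: lookup_add)

definition divides :: "'n expo \<Rightarrow> 'n expo \<Rightarrow> bool" where
  "divides s t \<longleftrightarrow> (\<exists>c. t = s + c)"

lemma divides_iff: "divides s t \<longleftrightarrow> (\<forall>i. Poly_Mapping.lookup s i \<le> Poly_Mapping.lookup t i)"
  by (simp add: divides_def expo_add_eq_iff)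

lemma divides_refl [simp]: "divides s s"
  by (simp add: divides_iff)

lemma divides_trans: "divides r s \<Longrightarrow> divides s t \<Longrightarrow> divides r t"
  unfolding divides_iff using le_trans by blast

lemma divides_antisym: "divides s t \<Longrightarrow> divides t s \<Longrightarrow> s = t"
  by (auto simp: divides_iff intro!: poly_mapping_eqI antisym)

lemma monom_dvd_iff:
  "(monom s :: ('n, 'k::comm_ring_1) mpoly) dvd monom t \<longleftrightarrow> divides s t"
proof
  assume "(monom s :: ('n, 'k) mpoly) dvd monom t"
  then obtain r :: "('n, 'k) mpoly" where "monom t = monom s * r" by (auto simp: dvd_def)
  then have "t \<in> (+) s ` Poly_Mapping.keys r"
    using keys_single_times[of s 1 r] by (metis keys_single singletonI subsetD one_neq_zero)
  then show "divides s t" by (auto simp: divides_def)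
next
  assume "divides s t"
  then obtain c where "t = s + c" by (auto simp: divides_def)
  then have "monom t = (monom s :: ('n, 'k) mpoly) * monom c" by (simp add: monom_mult)
  then show "(monom s :: ('n, 'k) mpoly) dvd monom t" by simp
qed

text \<open>The polynomials all of whose monomials are divisible by some \<open>x\<^bsup>m\<^esup>\<close>, \<open>m \<in> M\<close>, form an ideal.\<close>

lemma monom_in_monomial_ideal:
  assumes "(monom t :: ('n, 'k::comm_ring_1) mpoly) \<in> ideal_gen (monom ` M)"
  shows "\<exists>m\<in>M. divides m t"
proof -
  let ?J = "{f :: ('n, 'k) mpoly. \<forall>t\<in>Poly_Mapping.keys f. \<exists>m\<in>M. divides m t}"
  have "ideal_gen (monom ` M) \<subseteq> ?J"
  proof (rule ideal_gen_minimal)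
    fix f g assume "f \<in> ?J" "g \<in> ?J"
    then show "f + g \<in> ?J" using keys_add[of f g] by blast
  next
    fix r f assume f: "f \<in> ?J"
    show "r * f \<in> ?J"
    proof (clarify)
      fix t assume "t \<in> Poly_Mapping.keys (r * f)"
      then obtain a b where t: "t = a + b" "b \<in> Poly_Mapping.keys f"
        using keys_mult[of r f] by blast
      then obtain m where "m \<in> M" "divides m b" using f by blast
      moreover have "divides b t" by (auto simp: divides_def t add.commute)
      ultimately show "\<exists>m\<in>M. divides m t" using divides_trans by blast
    qed
  qed (auto intro!: bexI)
  with assms show ?thesis by auto
qed

section \<open>Dickson's lemma\<close>

text \<open>A monotone subsequence always exists, and one that is nonincreasing is eventually constant.\<close>

lemma nat_seq_mono_subseq:
  fixes s :: "nat \<Rightarrow> nat"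
  shows "\<exists>f :: nat \<Rightarrow> nat. strict_mono f \<and> mono (s \<circ> f)"
proof -
  obtain f :: "nat \<Rightarrow> nat" where f: "strict_mono f" "monoseq (\<lambda>n. s (f n))"
    using seq_monosub by blast
  show ?thesis
  proof (cases "mono (s \<circ> f)")
    case False
    with f have dec: "s (f n) \<le> s (f m)" if "m \<le> n" for m n
      using that by (auto simp: monoseq_def mono_def)
    define N where "N = (ARG_MIN (s \<circ> f) n. True)"
    have N: "s (f N) \<le> s (f n)" for n
      using arg_min_nat_le[of "\<lambda>_. True" n "s \<circ> f"] by (simp add: N_def)
    have "s (f (n + N)) = s (f N)" for n
      using N[of "n + N"] dec[of N "n + N"] by simp
    moreover have "strict_mono (\<lambda>n. f (n + N))"
      using f(1) by (simp add: strict_mono_def)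
    ultimately have "strict_mono (\<lambda>n. f (n + N)) \<and> mono (s \<circ> (\<lambda>n. f (n + N)))"
      by (simp add: mono_def)
    then show ?thesis by blast
  qed (use f in blast)
qed

text \<open>One coordinate at a time: a further subsequence keeps the coordinates treated before
  nondecreasing.\<close>

lemma dickson_subseq:
  fixes s :: "nat \<Rightarrow> 'i \<Rightarrow> nat"
  assumes "finite I"
  shows "\<exists>f :: nat \<Rightarrow> nat. strict_mono f \<and> (\<forall>i\<in>I. mono (\<lambda>n. s (f n) i))"
  using assms
proof induction
  case empty
  show ?case by (rule exI[of _ id]) (simp add: strict_mono_def)
next
  case (insert i I)
  then obtain f :: "nat \<Rightarrow> nat" where f: "strict_mono f" "\<And>j. j \<in> I \<Longrightarrow> mono (\<lambda>n. s (f n) j)" by blast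
  obtain g :: "nat \<Rightarrow> nat" where g: "strict_mono g" "mono ((\<lambda>n. s (f n) i) \<circ> g)"
    using nat_seq_mono_subseq by blast
  have "strict_mono (f \<circ> g)" using f g by (simp add: strict_mono_def)
  moreover have "mono (\<lambda>n. s ((f \<circ> g) n) j)" if "j \<in> insert i I" for j
  proof (cases "j = i")
    case True
    with g show ?thesis by (simp add: comp_def)
  next
    case False
    with that f(2) have "mono (\<lambda>n. s (f n) j)" by blast
    moreover have "mono g" using g(1) by (rule strict_mono_mono)
    ultimately show ?thesis by (simp add: mono_def)
  qed
  ultimately show ?case by blast
qed

lemma dickson:
  fixes M :: "'n::finite expo set"
  assumes "infinite M"
  obtains s t where "s \<in> M" "t \<in> M" "s \<noteq> t" "divides s t"
proof -
  obtain e :: "nat \<Rightarrow> 'n expo" where e: "inj e" "range e \<subseteq> M"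
    using assms infinite_countable_subset by blast
  obtain f :: "nat \<Rightarrow> nat" where f: "strict_mono f"
    "\<And>i. mono (\<lambda>n. Poly_Mapping.lookup (e (f n)) i)"
    using dickson_subseq[of UNIV "\<lambda>n. Poly_Mapping.lookup (e n)"] by auto
  show ?thesis
  proof
    show "divides (e (f 0)) (e (f 1))"
      unfolding divides_iff using f(2) by (simp add: mono_def)
    have "f 0 \<noteq> f 1" using f(1) strict_monoD[of f 0 1] by simp
    then show "e (f 0) \<noteq> e (f 1)" using e(1) by (simp add: inj_eq)
  qed (use e in auto)
qed

section \<open>Fibres of the grading and toric ideals\<close>

definition expo_vec :: "'n::finite expo \<Rightarrow> int ^ 'n" where
  "expo_vec s = (\<chi> i. int (Poly_Mapping.lookup s i))"

text \<open>Two exponents have the same \<open>A\<close>-degree iff their monomials agree modulo the toric ideal. The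
  exponents of a given degree are called a fibre.\<close>

definition adeg :: "int ^ 'n::finite ^ 'm \<Rightarrow> 'n expo \<Rightarrow> int ^ 'm" where
  "adeg A s = A *v expo_vec s"

lemma expo_vec_nth [simp]: "expo_vec s $ i = int (Poly_Mapping.lookup s i)"
  by (simp add: expo_vec_def)

lemma expo_vec_add: "expo_vec (s + t) = expo_vec s + expo_vec t"
  by (simp add: vec_eq_iff lookup_add)

lemma expo_vec_inject [simp]: "expo_vec s = expo_vec t \<longleftrightarrow> s = t"
  by (auto simp: vec_eq_iff intro: poly_mapping_eqI)

lemma lookup_pos_part [simp]: "Poly_Mapping.lookup (pos_part u) i = nat (u $ i)"
  by (simp add: pos_part.rep_eq)

lemma expo_vec_pos_part_diff: "expo_vec (pos_part u) - expo_vec (pos_part (- u)) = u"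
  by (simp add: vec_eq_iff)

lemma adeg_add: "adeg A (s + t) = adeg A s + adeg A t"
  by (simp add: adeg_def expo_vec_add matrix_vector_right_distrib)

lemma adeg_eq_iff: "adeg A s = adeg A t \<longleftrightarrow> expo_vec s - expo_vec t \<in> int_kernel A"
  by (simp add: adeg_def int_kernel_def matrix_vector_mult_diff_distrib)

lemma adeg_pos_part: "u \<in> int_kernel A \<Longrightarrow> adeg A (pos_part u) = adeg A (pos_part (- u))"
  by (simp add: adeg_eq_iff expo_vec_pos_part_diff)

lemma pos_part_neq: "u \<noteq> 0 \<Longrightarrow> pos_part u \<noteq> pos_part (- u)"
  using expo_vec_pos_part_diff[of u] by auto

lemma kernel_binomial_uminus: "kernel_binomial (- u) = - kernel_binomial u"
  by (simp add: kernel_binomial_def)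

lemma int_kernel_diff: "u \<in> int_kernel A \<Longrightarrow> v \<in> int_kernel A \<Longrightarrow> u - v \<in> int_kernel A"
  by (simp add: int_kernel_def matrix_vector_mult_diff_distrib)

lemma int_kernel_add: "u \<in> int_kernel A \<Longrightarrow> v \<in> int_kernel A \<Longrightarrow> u + v \<in> int_kernel A"
  by (simp add: int_kernel_def matrix_vector_right_distrib)

lemma int_kernel_uminus: "u \<in> int_kernel A \<Longrightarrow> - u \<in> int_kernel A"
  using int_kernel_diff[of 0 A u] by (simp add: int_kernel_def)

lemma int_kernel_scale_iff: "c \<noteq> 0 \<Longrightarrow> c *s u \<in> int_kernel A \<longleftrightarrow> u \<in> int_kernel A"
proof -
  have "A *v (c *s u) = c *s (A *v u)"
    by (simp add: vec_eq_iff matrix_vector_mult_def sum_distrib_left mult.left_commute)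
  then show "c \<noteq> 0 \<Longrightarrow> ?thesis" by (simp add: int_kernel_def)
qed

text \<open>Cancelling the greatest common divisor of two monomials.\<close>

lemma expo_split:
  fixes s t :: "'n::finite expo"
  defines "u \<equiv> expo_vec s - expo_vec t"
  obtains c where "s = c + pos_part u" "t = c + pos_part (- u)"
proof
  show "s = (s - pos_part u) + pos_part u" "t = (s - pos_part u) + pos_part (- u)"
    by (auto intro!: poly_mapping_eqI simp: lookup_add lookup_minus u_def)
qed

lemma binomial_in_toric_ideal:
  assumes "adeg A s = adeg A t"
  shows "(monom s - monom t :: ('n::finite, 'k::field) mpoly) \<in> toric_ideal A"
proof -
  define u where "u = expo_vec s - expo_vec t"
  obtain c where c: "s = c + pos_part u" "t = c + pos_part (- u)"
    using expo_split unfolding u_def by metis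
  have "u \<in> int_kernel A" using assms by (simp add: adeg_eq_iff u_def)
  then have "monom c * kernel_binomial u \<in> (toric_ideal A :: ('n, 'k) mpoly set)"
    unfolding toric_ideal_def by (intro ideal_gen_mult ideal_gen_base) auto
  then show ?thesis
    by (simp add: kernel_binomial_def right_diff_distrib monom_mult flip: c)
qed

definition fibre_sum :: "int ^ 'n::finite ^ 'm \<Rightarrow> int ^ 'm \<Rightarrow> ('n, 'k::comm_ring_1) mpoly \<Rightarrow> 'k" where
  "fibre_sum A d f = (\<Sum>t\<in>Poly_Mapping.keys f. if adeg A t = d then Poly_Mapping.lookup f t else 0)"

lemma fibre_sum_superset:
  assumes "finite T" "Poly_Mapping.keys f \<subseteq> T"
  shows "fibre_sum A d f = (\<Sum>t\<in>T. if adeg A t = d then Poly_Mapping.lookup f t else 0)"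
  unfolding fibre_sum_def
  by (rule sum.mono_neutral_left) (use assms in \<open>auto simp: in_keys_iff\<close>)

lemma fibre_sum_add: "fibre_sum A d (f + g) = fibre_sum A d f + fibre_sum A d g"
proof -
  let ?T = "Poly_Mapping.keys f \<union> Poly_Mapping.keys g"
  have "fibre_sum A d h = (\<Sum>t\<in>?T. if adeg A t = d then Poly_Mapping.lookup h t else 0)"
    if "h \<in> {f, g, f + g}" for h
    by (rule fibre_sum_superset) (use that keys_add[of f g] in auto)
  then show ?thesis
    by (auto simp: lookup_add simp flip: sum.distrib intro!: sum.cong)
qed

lemma fibre_sum_0 [simp]: "fibre_sum A d 0 = 0"
  by (simp add: fibre_sum_def)

lemma fibre_sum_sum: "fibre_sum A d (sum F T) = (\<Sum>t\<in>T. fibre_sum A d (F t))"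
  by (induction T rule: infinite_finite_induct) (auto simp: fibre_sum_add)

lemma fibre_sum_single_times:
  "fibre_sum A d (Poly_Mapping.single a c * f) = c * fibre_sum A (d - adeg A a) f"
proof -
  have "fibre_sum A d (Poly_Mapping.single a c * f) =
    (\<Sum>t\<in>(+) a ` Poly_Mapping.keys f.
       if adeg A t = d then Poly_Mapping.lookup (Poly_Mapping.single a c * f) t else 0)"
    by (rule fibre_sum_superset) (use keys_single_times[of a c f] in auto)
  also have "\<dots> = (\<Sum>t\<in>Poly_Mapping.keys f.
       if adeg A (a + t) = d then c * Poly_Mapping.lookup f t else 0)"
    by (subst sum.reindex) (auto simp: inj_on_def lookup_single_times intro!: sum.cong)
  finally show ?thesis
    by (auto simp: fibre_sum_def sum_distrib_left adeg_add algebra_simps intro!: sum.cong)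
qed

lemma fibre_sum_times_eq_0:
  assumes "\<And>d. fibre_sum A d f = 0"
  shows "fibre_sum A d (r * f) = 0"
  by (subst poly_mapping_expansion[of r])
    (simp add: sum_distrib_right fibre_sum_sum fibre_sum_single_times assms)

lemma fibre_sum_binomial:
  assumes "adeg A s = adeg A t"
  shows "fibre_sum A d (monom s - monom t) = 0"
proof (cases "s = t")
  case False
  with assms show ?thesis
    by (simp add: fibre_sum_def keys_binomial lookup_minus lookup_single when_def)
qed simp

text \<open>Multiplying by a monomial only shifts the fibres, so the polynomials with all fibre sums
  \<open>0\<close> form an ideal, and the generators of the toric ideal belong to it.\<close>

lemma fibre_sum_toric_ideal:
  assumes "f \<in> toric_ideal A"
  shows "fibre_sum A d f = 0"
proof -
  have "toric_ideal A \<subseteq> {f. \<forall>d. fibre_sum A d f = 0}"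
    unfolding toric_ideal_def
    by (rule ideal_gen_minimal)
      (auto simp: fibre_sum_add fibre_sum_times_eq_0 kernel_binomial_def
        intro!: fibre_sum_binomial adeg_pos_part)
  with assms show ?thesis by blast
qed

text \<open>A single monomial of \<open>f\<close> in a fibre would make the fibre sum nonzero.\<close>

lemma toric_ideal_other_key:
  assumes "f \<in> toric_ideal A" "t \<in> Poly_Mapping.keys f"
  obtains s where "s \<in> Poly_Mapping.keys f" "s \<noteq> t" "adeg A s = adeg A t"
proof (rule ccontr)
  assume "\<not> thesis"
  with that have "adeg A s = adeg A t \<longleftrightarrow> s = t" if "s \<in> Poly_Mapping.keys f" for s
    using that by blast
  then have "fibre_sum A (adeg A t) f =
      (\<Sum>s\<in>Poly_Mapping.keys f. if s = t then Poly_Mapping.lookup f s else 0)"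
    unfolding fibre_sum_def by (intro sum.cong) auto
  with assms(2) have "fibre_sum A (adeg A t) f = Poly_Mapping.lookup f t" by simp
  with assms show False by (simp add: fibre_sum_toric_ideal in_keys_iff)
qed

lemma binomial_in_toric_ideal_iff:
  assumes "s \<noteq> t"
  shows "(monom s - monom t :: ('n::finite, 'k::field) mpoly) \<in> toric_ideal A
    \<longleftrightarrow> adeg A s = adeg A t"
proof
  assume "(monom s - monom t :: ('n, 'k) mpoly) \<in> toric_ideal A"
  then show "adeg A s = adeg A t"
    by (rule toric_ideal_other_key[of _ _ s]) (use assms in \<open>auto simp: keys_binomial\<close>)
qed (rule binomial_in_toric_ideal)


section \<open>Orders on exponents\<close>

locale additive_order =
  fixes le :: "'n expo \<Rightarrow> 'n expo \<Rightarrow> bool"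
  assumes linorder_le: "class.linorder le (\<lambda>s t. le s t \<and> s \<noteq> t)"
    and add_left: "le s t \<Longrightarrow> le (r + s) (r + t)"
begin

interpretation lo: linorder le "\<lambda>s t. le s t \<and> s \<noteq> t"
  by (rule linorder_le)

lemma le_refl [simp]: "le s s"
  by simp

lemma le_antisym: "le s t \<Longrightarrow> le t s \<Longrightarrow> s = t"
  by (rule lo.order.antisym)

lemma le_trans: "le r s \<Longrightarrow> le s t \<Longrightarrow> le r t"
  by (rule lo.order.trans)

lemma le_total: "le s t \<or> le t s"
  by (rule lo.linear)

lemma add_mono: "le s t \<Longrightarrow> le s' t' \<Longrightarrow> le (s + s') (t + t')"
  using add_left[of s t s'] add_left[of s' t' t] le_trans by (metis add.commute)

lemma add_left_iff: "le (r + s) (r + t) \<longleftrightarrow> le s t"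
  using add_left le_total le_antisym by (metis add_left_imp_eq)

lemma finite_ex_greatest:
  assumes "finite S" "S \<noteq> {}"
  shows "\<exists>m\<in>S. \<forall>s\<in>S. le s m"
  using assms
proof (induction rule: finite_ne_induct)
  case (insert x S)
  then obtain m where "m \<in> S" "\<forall>s\<in>S. le s m" by blast
  then show ?case using le_total[of x m] le_trans le_refl by (metis insert_iff)
qed simp

lemma finite_ex_least:
  assumes "finite S" "S \<noteq> {}"
  shows "\<exists>m\<in>S. \<forall>s\<in>S. le m s"
  using assms
proof (induction rule: finite_ne_induct)
  case (insert x S)
  then obtain m where "m \<in> S" "\<forall>s\<in>S. le m s" by blast
  then show ?case using le_total[of x m] le_trans le_refl by (metis insert_iff)
qed simp

lemma lead_expo_eq:
  "t \<in> Poly_Mapping.keys f \<Longrightarrow> (\<And>s. s \<in> Poly_Mapping.keys f \<Longrightarrow> le s t) \<Longrightarrow> lead_expo le f = t"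
  unfolding lead_expo_def by (rule the_equality) (auto intro: le_antisym)

lemma
  assumes "f \<noteq> 0"
  shows lead_expo_in_keys: "lead_expo le f \<in> Poly_Mapping.keys f"
    and le_lead_expo: "s \<in> Poly_Mapping.keys f \<Longrightarrow> le s (lead_expo le f)"
proof -
  obtain t where "t \<in> Poly_Mapping.keys f" "\<forall>s\<in>Poly_Mapping.keys f. le s t"
    using finite_ex_greatest[of "Poly_Mapping.keys f"] assms
    by (metis finite_keys keys_eq_empty)
  moreover from this have "lead_expo le f = t" by (intro lead_expo_eq) auto
  ultimately show "lead_expo le f \<in> Poly_Mapping.keys f"
    "s \<in> Poly_Mapping.keys f \<Longrightarrow> le s (lead_expo le f)" by auto
qed

lemma lead_expo_binomial:
  "le t s \<Longrightarrow> s \<noteq> t \<Longrightarrow> lead_expo le (monom s - monom t :: ('n, 'k::comm_ring_1) mpoly) = s"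
  by (rule lead_expo_eq) (auto simp: keys_binomial)

text \<open>The two leading exponents are the only exponents of \<open>f\<close> and \<open>g\<close> that add up to their sum, so
  nothing cancels there.\<close>

lemma lead_expo_mult:
  fixes f g :: "('n, 'k::field) mpoly"
  assumes "f \<noteq> 0" "g \<noteq> 0"
  shows "lead_expo le (f * g) = lead_expo le f + lead_expo le g"
proof (rule lead_expo_eq)
  let ?a = "lead_expo le f" and ?b = "lead_expo le g"
  have eq: "a = ?a \<and> b = ?b"
    if "a \<in> Poly_Mapping.keys f" "b \<in> Poly_Mapping.keys g" "a + b = ?a + ?b" for a b
  proof -
    have "le a ?a" "le b ?b" using that assms le_lead_expo by auto
    then have "le (?a + b) (?a + ?b)" "le (a + b) (?a + b)"
      using add_left[of b ?b ?a] add_left[of a ?a b] by (simp_all only: add.commute)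
    with that(3) have "a + b = ?a + b" by (metis le_antisym)
    with that(3) show ?thesis by auto
  qed
  have "f * g = (\<Sum>a\<in>Poly_Mapping.keys f. Poly_Mapping.single a (Poly_Mapping.lookup f a) * g)"
    by (metis poly_mapping_expansion sum_distrib_right)
  then have "Poly_Mapping.lookup (f * g) (?a + ?b) = (\<Sum>a\<in>Poly_Mapping.keys f.
      Poly_Mapping.lookup (Poly_Mapping.single a (Poly_Mapping.lookup f a) * g) (?a + ?b))"
    by (simp add: lookup_sum)
  also have "\<dots> = (\<Sum>a\<in>Poly_Mapping.keys f.
      if a = ?a then Poly_Mapping.lookup f ?a * Poly_Mapping.lookup g ?b else 0)"
  proof (rule sum.cong)
    fix a assume a: "a \<in> Poly_Mapping.keys f"
    show "Poly_Mapping.lookup (Poly_Mapping.single a (Poly_Mapping.lookup f a) * g) (?a + ?b) =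
      (if a = ?a then Poly_Mapping.lookup f ?a * Poly_Mapping.lookup g ?b else 0)"
    proof (cases "a = ?a")
      case False
      with a eq have "?a + ?b \<notin> (+) a ` Poly_Mapping.keys g" by force
      then have "?a + ?b \<notin> Poly_Mapping.keys (Poly_Mapping.single a (Poly_Mapping.lookup f a) * g)"
        using keys_single_times by blast
      with False show ?thesis by (simp add: in_keys_iff)
    qed (use lookup_single_times[of a "Poly_Mapping.lookup f a" g ?b] in simp)
  qed simp
  also have "\<dots> = Poly_Mapping.lookup f ?a * Poly_Mapping.lookup g ?b"
    using lead_expo_in_keys[OF assms(1)] by simp
  also have "\<dots> \<noteq> 0"
    using assms lead_expo_in_keys by (metis in_keys_iff no_zero_divisors)
  finally show "?a + ?b \<in> Poly_Mapping.keys (f * g)" by (simp add: in_keys_iff)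
  fix s assume "s \<in> Poly_Mapping.keys (f * g)"
  then show "le s (?a + ?b)"
    using keys_mult[of f g] assms le_lead_expo add_mono by blast
qed

end

lemma monomial_order_iff: "monomial_order le \<longleftrightarrow> additive_order le \<and> (\<forall>t. le 0 t)"
  by (auto simp: monomial_order_def additive_order_def)

text \<open>Integer weights, with ties broken lexicographically along an enumeration \<open>e\<close> of the
  variables. Negative weights are allowed: the order is then additive, but \<open>0\<close> need not be least.\<close>

definition weight :: "('n::finite \<Rightarrow> int) \<Rightarrow> 'n expo \<Rightarrow> int" where
  "weight \<omega> s = (\<Sum>i\<in>UNIV. \<omega> i * int (Poly_Mapping.lookup s i))"

definition lex_le :: "('n \<Rightarrow> nat) \<Rightarrow> 'n expo \<Rightarrow> 'n expo \<Rightarrow> bool" where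
  "lex_le e s t \<longleftrightarrow> s = t \<or> (\<exists>i. Poly_Mapping.lookup s i < Poly_Mapping.lookup t i \<and>
     (\<forall>j. e j < e i \<longrightarrow> Poly_Mapping.lookup s j = Poly_Mapping.lookup t j))"

definition variable_index :: "'n::finite \<Rightarrow> nat" where
  "variable_index = (SOME e. inj e)"

definition weight_le :: "('n::finite \<Rightarrow> int) \<Rightarrow> 'n expo \<Rightarrow> 'n expo \<Rightarrow> bool" where
  "weight_le \<omega> s t \<longleftrightarrow> weight \<omega> s < weight \<omega> t \<or> weight \<omega> s = weight \<omega> t \<and> lex_le variable_index s t"

lemma inj_variable_index: "inj (variable_index :: 'n::finite \<Rightarrow> nat)"
proof -
  have "\<exists>e :: 'n \<Rightarrow> nat. inj e"
    using finite_imp_inj_to_nat_seg[of "UNIV :: 'n set"] by auto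
  then show ?thesis unfolding variable_index_def by (rule someI_ex)
qed

lemma weight_add: "weight \<omega> (s + t) = weight \<omega> s + weight \<omega> t"
  by (simp add: weight_def lookup_add distrib_left sum.distrib)

lemma weight_uminus: "weight (\<lambda>i. - \<omega> i) s = - weight \<omega> s"
  by (simp add: weight_def sum_negf)

lemma lex_le_total:
  assumes "inj e"
  shows "lex_le e s t \<or> lex_le e t s"
proof (cases "s = t")
  case False
  then have ex: "\<exists>i. Poly_Mapping.lookup s i \<noteq> Poly_Mapping.lookup t i"
    by (metis poly_mapping_eqI)
  define i where "i = (ARG_MIN e i. Poly_Mapping.lookup s i \<noteq> Poly_Mapping.lookup t i)"
  have i: "Poly_Mapping.lookup s i \<noteq> Poly_Mapping.lookup t i"
    using ex unfolding i_def by (metis (mono_tags) arg_min_natI)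
  have "Poly_Mapping.lookup s j = Poly_Mapping.lookup t j" if "e j < e i" for j
    using that arg_min_nat_le[of "\<lambda>i. Poly_Mapping.lookup s i \<noteq> Poly_Mapping.lookup t i" j e]
    unfolding i_def by force
  with i show ?thesis unfolding lex_le_def by (metis nat_neq_iff)
qed (simp add: lex_le_def)

lemma lex_le_antisym:
  assumes "inj e" "lex_le e s t" "lex_le e t s"
  shows "s = t"
proof (rule ccontr)
  assume "s \<noteq> t"
  with assms obtain i j where
    i: "Poly_Mapping.lookup s i < Poly_Mapping.lookup t i"
      "\<And>k. e k < e i \<Longrightarrow> Poly_Mapping.lookup s k = Poly_Mapping.lookup t k" and
    j: "Poly_Mapping.lookup t j < Poly_Mapping.lookup s j"
      "\<And>k. e k < e j \<Longrightarrow> Poly_Mapping.lookup s k = Poly_Mapping.lookup t k"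
    by (fastforce simp: lex_le_def)
  then have "\<not> e i < e j" "\<not> e j < e i" by force+
  then have "i = j" using assms(1) by (simp add: inj_eq)
  with i j show False by simp
qed

lemma lex_le_trans:
  assumes "inj e" "lex_le e r s" "lex_le e s t"
  shows "lex_le e r t"
proof (cases "r = s \<or> s = t")
  case False
  with assms obtain i j where
    i: "Poly_Mapping.lookup r i < Poly_Mapping.lookup s i"
      "\<And>k. e k < e i \<Longrightarrow> Poly_Mapping.lookup r k = Poly_Mapping.lookup s k" and
    j: "Poly_Mapping.lookup s j < Poly_Mapping.lookup t j"
      "\<And>k. e k < e j \<Longrightarrow> Poly_Mapping.lookup s k = Poly_Mapping.lookup t k"
    by (auto simp: lex_le_def)
  consider "e i < e j" | "i = j" | "e j < e i"
    using assms(1) by (metis injD nat_neq_iff)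
  then show ?thesis
  proof cases
    case 1
    then show ?thesis unfolding lex_le_def using i j
      by (intro disjI2 exI[of _ i]) force
  next
    case 2
    then show ?thesis unfolding lex_le_def using i j
      by (intro disjI2 exI[of _ i]) force
  next
    case 3
    then show ?thesis unfolding lex_le_def using i j
      by (intro disjI2 exI[of _ j]) force
  qed
qed (use assms in auto)

lemma additive_order_weight_le: "additive_order (weight_le (\<omega> :: 'n::finite \<Rightarrow> int))"
proof
  note [simp] = weight_le_def
  fix r s t :: "'n expo"
  show "weight_le \<omega> s s" by (simp add: lex_le_def)
  show "(weight_le \<omega> s t \<and> s \<noteq> t) = (weight_le \<omega> s t \<and> \<not> weight_le \<omega> t s)"
    using lex_le_antisym[OF inj_variable_index, of s t] by (cases "s = t") auto
  show "weight_le \<omega> r s \<Longrightarrow> weight_le \<omega> s t \<Longrightarrow> weight_le \<omega> r t"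
    using lex_le_trans[OF inj_variable_index] by auto
  show "weight_le \<omega> s t \<Longrightarrow> weight_le \<omega> t s \<Longrightarrow> s = t"
    using lex_le_antisym[OF inj_variable_index] by auto
  show "weight_le \<omega> s t \<or> weight_le \<omega> t s"
    using lex_le_total[OF inj_variable_index, of s t] by auto
  show "weight_le \<omega> s t \<Longrightarrow> weight_le \<omega> (r + s) (r + t)"
    by (auto simp: weight_add lex_le_def lookup_add)
qed

lemma monomial_order_weight_le:
  assumes "\<And>i. 0 \<le> \<omega> i"
  shows "monomial_order (weight_le \<omega>)"
proof -
  have "weight_le \<omega> 0 t" for t
  proof -
    have "0 \<le> weight \<omega> t" unfolding weight_def by (intro sum_nonneg) (simp add: assms)
    moreover have "weight \<omega> 0 = 0" by (simp add: weight_def)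
    moreover have "lex_le variable_index 0 t"
      using lex_le_total[OF inj_variable_index, of 0 t] by (auto simp: lex_le_def)
    ultimately show ?thesis by (auto simp: weight_le_def)
  qed
  then show ?thesis by (simp add: monomial_order_iff additive_order_weight_le)
qed

section \<open>Reduced Groebner bases of toric ideals\<close>

locale pointed_kernel =
  fixes A :: "int ^ 'n::finite ^ 'm::finite"
  assumes pointed: "int_kernel A \<inter> {u. \<forall>i. 0 \<le> u $ i} = {0}"
begin

lemma nonneg_kernel_eq_0: "u \<in> int_kernel A \<Longrightarrow> (\<And>i. 0 \<le> u $ i) \<Longrightarrow> u = 0"
  using pointed by blast

lemma divides_adeg_eq:
  assumes "divides s t" "adeg A s = adeg A t"
  shows "s = t"
proof -
  have "expo_vec t - expo_vec s = 0"
    by (rule nonneg_kernel_eq_0) (use assms in \<open>auto simp: divides_iff simp flip: adeg_eq_iff\<close>)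
  then show ?thesis by simp
qed

text \<open>Of two comparable exponents in a fibre, the difference is a nonnegative kernel vector, so
  Dickson's lemma applies.\<close>

lemma finite_fibre: "finite {s. adeg A s = d}"
  by (rule ccontr) (erule dickson, use divides_adeg_eq in auto)

end

locale pointed_kernel_order = pointed_kernel A for A :: "int ^ 'n::finite ^ 'm::finite" +
  fixes le :: "'n expo \<Rightarrow> 'n expo \<Rightarrow> bool"
  assumes monomial_order: "monomial_order le"
begin

sublocale additive_order le
  using monomial_order by (simp add: monomial_order_iff)

lemma divides_le: "divides s t \<Longrightarrow> le s t"
  using monomial_order add_left[of 0 _ s] by (auto simp: monomial_order_iff divides_def)

text \<open>The standard exponents are the least ones of their fibres; they index the monomials
  outside the initial ideal.\<close>

definition standard :: "'n expo \<Rightarrow> bool" where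
  "standard t \<longleftrightarrow> (\<forall>s. adeg A s = adeg A t \<longrightarrow> le t s)"

definition normal_form :: "'n expo \<Rightarrow> 'n expo" where
  "normal_form t = (THE s. adeg A s = adeg A t \<and> standard s)"

text \<open>The minimal generators of the initial ideal.\<close>

definition leads :: "'n expo set" where
  "leads = {a. \<not> standard a \<and> (\<forall>b. divides b a \<and> \<not> standard b \<longrightarrow> b = a)}"

definition gb :: "('n, 'k::field) mpoly set" where
  "gb = (\<lambda>a. monom a - monom (normal_form a)) ` leads"

lemma normal_form_eq: "adeg A s = adeg A t \<Longrightarrow> standard s \<Longrightarrow> normal_form t = s"
  unfolding normal_form_def by (rule the_equality) (auto simp: standard_def intro: le_antisym)

lemma
  shows adeg_normal_form: "adeg A (normal_form t) = adeg A t"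
    and standard_normal_form: "standard (normal_form t)"
proof -
  obtain s where "adeg A s = adeg A t" "\<forall>r\<in>{r. adeg A r = adeg A t}. le s r"
    using finite_ex_least[OF finite_fibre, of "adeg A t"] by blast
  then have s: "adeg A s = adeg A t" "standard s" by (auto simp: standard_def)
  then have "normal_form t = s" by (rule normal_form_eq)
  with s show "adeg A (normal_form t) = adeg A t" "standard (normal_form t)" by auto
qed

lemma normal_form_le: "le (normal_form t) t"
  using standard_normal_form[of t] adeg_normal_form[of t] by (simp add: standard_def)

lemma normal_form_neq: "\<not> standard t \<Longrightarrow> normal_form t \<noteq> t"
  using standard_normal_form[of t] by auto

lemma nonstandard_iff: "\<not> standard t \<longleftrightarrow> (\<exists>s. adeg A s = adeg A t \<and> le s t \<and> s \<noteq> t)"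
  unfolding standard_def using le_total le_antisym by metis

lemma nonstandard_divides:
  assumes "\<not> standard s" "divides s t"
  shows "\<not> standard t"
proof -
  obtain c where t: "t = c + s" using assms(2) by (auto simp: divides_def add.commute)
  obtain r where "adeg A r = adeg A s" "le r s" "r \<noteq> s" using assms(1) nonstandard_iff by blast
  then have "adeg A (c + r) = adeg A t" "le (c + r) t" "c + r \<noteq> t"
    by (auto simp: t adeg_add add_left)
  then show ?thesis using nonstandard_iff by blast
qed

lemma nonstandard_divisible_by_lead:
  assumes "\<not> standard t"
  obtains a where "a \<in> leads" "divides a t"
proof -
  let ?D = "{s. divides s t \<and> \<not> standard s}"
  let ?size = "\<lambda>s. \<Sum>i\<in>UNIV. Poly_Mapping.lookup s i"
  define a where "a = (ARG_MIN ?size s. s \<in> ?D)"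
  have a: "a \<in> ?D" unfolding a_def by (rule arg_min_natI[of _ t]) (use assms in auto)
  have "b = a" if b: "divides b a" "\<not> standard b" for b
  proof -
    have "b \<in> ?D" using a b divides_trans by blast
    then have "?size a \<le> ?size b"
      unfolding a_def by (rule arg_min_nat_le)
    moreover obtain c where c: "a = b + c" using b(1) by (auto simp: divides_def)
    ultimately have "?size c = 0" by (simp add: lookup_add sum.distrib)
    then have "c = 0" by (auto intro: poly_mapping_eqI)
    with c show "b = a" by simp
  qed
  with a have "a \<in> leads" by (auto simp: leads_def)
  with a that show ?thesis by blast
qed

lemma finite_leads: "finite leads"
  by (rule ccontr) (erule dickson, auto simp: leads_def)

text \<open>By the vanishing of fibre sums, \<open>f\<close> has another, hence smaller, monomial in the fibre of its
  leading one.\<close>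

lemma lead_expo_nonstandard:
  fixes f :: "('n, 'k::field) mpoly"
  assumes "f \<in> toric_ideal A" "f \<noteq> 0"
  shows "\<not> standard (lead_expo le f)"
proof -
  obtain s where "s \<in> Poly_Mapping.keys f" "s \<noteq> lead_expo le f" "adeg A s = adeg A (lead_expo le f)"
    using toric_ideal_other_key[OF assms(1) lead_expo_in_keys[OF assms(2)]] .
  then show ?thesis using le_lead_expo[OF assms(2)] nonstandard_iff by blast
qed

lemma monom_nonstandard_in_initial_ideal:
  assumes "\<not> standard t"
  shows "(monom t :: ('n, 'k::field) mpoly) \<in> initial_ideal le (toric_ideal A)"
proof -
  let ?f = "monom t - monom (normal_form t) :: ('n, 'k) mpoly"
  have "?f \<in> toric_ideal A - {0}"
    using normal_form_neq[OF assms] by (auto simp: binomial_in_toric_ideal adeg_normal_form)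
  then have "lead_monom le ?f \<in> initial_ideal le (toric_ideal A)"
    unfolding initial_ideal_def by (intro ideal_gen_base) auto
  then show ?thesis
    using normal_form_neq[OF assms] by (simp add: lead_monom_def lead_expo_binomial normal_form_le)
qed

lemma lead_expo_gb:
  "a \<in> leads \<Longrightarrow> lead_expo le (monom a - monom (normal_form a) :: ('n, 'k::field) mpoly) = a"
  by (metis (mono_tags, lifting) leads_def lead_expo_binomial mem_Collect_eq normal_form_le
      normal_form_neq)

lemma leads_normal_form_neq: "a \<in> leads \<Longrightarrow> normal_form a \<noteq> a"
  by (auto simp: leads_def dest: normal_form_neq)

lemma gb_subset: "(gb :: ('n, 'k::field) mpoly set) \<subseteq> toric_ideal A"
  by (auto simp: gb_def binomial_in_toric_ideal adeg_normal_form)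

text \<open>A normal form is standard and so has no divisor among the nonstandard exponents: this makes
  the basis reduced.\<close>

lemma reduced_groebner_basis_gb:
  "reduced_groebner_basis le (toric_ideal A) (gb :: ('n, 'k::field) mpoly set)"
proof -
  let ?G = "gb :: ('n, 'k) mpoly set" and ?I = "toric_ideal A :: ('n, 'k) mpoly set"
  let ?b = "\<lambda>a. monom a - monom (normal_form a) :: ('n, 'k) mpoly"
  have no0: "0 \<notin> ?G"
    by (auto simp: gb_def) (metis leads_normal_form_neq)
  have "initial_ideal le ?I \<subseteq> ideal_gen (lead_monom le ` ?G)"
    unfolding initial_ideal_def
  proof (rule ideal_gen_subset, rule image_subsetI)
    fix f assume "f \<in> ?I - {0}"
    then have f: "f \<in> ?I" "f \<noteq> 0" by auto
    obtain a where a: "a \<in> leads" "divides a (lead_expo le f)"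
      using nonstandard_divisible_by_lead[OF lead_expo_nonstandard[OF f]] .
    then obtain c where c: "lead_expo le f = a + c" by (auto simp: divides_def)
    have "lead_monom le (?b a) \<in> ideal_gen (lead_monom le ` ?G)"
      by (rule ideal_gen_base) (use a(1) in \<open>auto simp: gb_def\<close>)
    then have "monom c * lead_monom le (?b a) \<in> ideal_gen (lead_monom le ` ?G)"
      by (rule ideal_gen_mult)
    then show "lead_monom le f \<in> ideal_gen (lead_monom le ` ?G)"
      using a(1) by (simp add: lead_monom_def lead_expo_gb monom_mult c add.commute)
  qed
  moreover have "ideal_gen (lead_monom le ` ?G) \<subseteq> initial_ideal le ?I"
    unfolding initial_ideal_def
    by (intro ideal_gen_mono image_mono) (use no0 gb_subset in auto)
  moreover have "finite ?G" by (simp add: gb_def finite_leads)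
  ultimately have "groebner_basis le ?I ?G"
    using no0 gb_subset by (auto simp: groebner_basis_def)
  moreover have "Poly_Mapping.lookup g (lead_expo le g) = 1" if "g \<in> ?G" for g
    using that leads_normal_form_neq
    by (auto simp: gb_def lead_expo_gb lookup_minus lookup_single when_def)
  moreover have "\<not> lead_monom le g dvd (monom t :: ('n, 'k) mpoly)"
    if gh: "g \<in> ?G" "h \<in> ?G" "g \<noteq> h" "t \<in> Poly_Mapping.keys h" for g h t
  proof -
    obtain a b where ab: "a \<in> leads" "b \<in> leads" "g = ?b a" "h = ?b b"
      using gh by (auto simp: gb_def)
    have "a \<noteq> b" using ab gh by auto
    have "t = b \<or> t = normal_form b"
      using that(4) leads_normal_form_neq[OF ab(2)] by (auto simp: ab keys_binomial)
    moreover have "\<not> divides a b" using ab \<open>a \<noteq> b\<close> by (auto simp: leads_def)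
    moreover have "\<not> divides a (normal_form b)"
      using ab(1) standard_normal_form[of b] nonstandard_divides by (auto simp: leads_def)
    ultimately have "\<not> divides a t" by auto
    then show ?thesis using ab(1) by (simp add: ab lead_monom_def lead_expo_gb monom_dvd_iff)
  qed
  ultimately show ?thesis using no0 by (auto simp: reduced_groebner_basis_def)
qed

text \<open>All monomials of an element of a reduced Groebner basis except its leading one are
  standard, so they lie in different fibres; since the coefficients add up to \<open>0\<close> on each
  fibre, only the normal form of the leading exponent can occur.\<close>

lemma reduced_groebner_basis_subset_gb:
  fixes G :: "('n, 'k::field) mpoly set"
  assumes "reduced_groebner_basis le (toric_ideal A) G"
  shows "G \<subseteq> gb"
proof
  fix g assume g: "g \<in> G"
  have GI: "G \<subseteq> toric_ideal A" and no0: "0 \<notin> G"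
    and gen: "ideal_gen (lead_monom le ` G) = initial_ideal le (toric_ideal A)"
    and lc: "Poly_Mapping.lookup g (lead_expo le g) = 1"
    and red: "\<And>h h' t. h \<in> G \<Longrightarrow> h' \<in> G \<Longrightarrow> h \<noteq> h' \<Longrightarrow> t \<in> Poly_Mapping.keys h'
        \<Longrightarrow> \<not> divides (lead_expo le h) t"
    using assms g
    by (auto simp: reduced_groebner_basis_def groebner_basis_def lead_monom_def monom_dvd_iff)
  have "g \<noteq> 0" "g \<in> toric_ideal A" using g GI no0 by auto
  define a where "a = lead_expo le g"
  have a: "a \<in> Poly_Mapping.keys g" and le_a: "\<And>t. t \<in> Poly_Mapping.keys g \<Longrightarrow> le t a"
    using \<open>g \<noteq> 0\<close> lead_expo_in_keys le_lead_expo by (auto simp: a_def)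
  have lead_div: "\<exists>h\<in>G. divides (lead_expo le h) t" if "\<not> standard t" for t
  proof -
    have "(monom t :: ('n, 'k) mpoly) \<in> ideal_gen (monom ` (lead_expo le ` G))"
      using monom_nonstandard_in_initial_ideal[OF that, where 'k = 'k]
      unfolding gen[symmetric] by (simp add: lead_monom_def[abs_def] image_image)
    then show ?thesis using monom_in_monomial_ideal by blast
  qed
  have tail: "standard t" if "t \<in> Poly_Mapping.keys g" "t \<noteq> a" for t
  proof (rule ccontr)
    assume "\<not> standard t"
    then obtain h where h: "h \<in> G" "divides (lead_expo le h) t" using lead_div by blast
    with red[OF h(1) g _ that(1)] have "h = g" by auto
    with h(2) have "le a t" by (simp add: a_def divides_le)
    with le_a[OF that(1)] that(2) show False using le_antisym by blast
  qed
  have nonstd: "\<not> standard a"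
    unfolding a_def by (rule lead_expo_nonstandard) fact+
  have "b = a" if b: "divides b a" "\<not> standard b" for b
  proof -
    obtain h where h: "h \<in> G" "divides (lead_expo le h) b" using lead_div b(2) by blast
    then have "divides (lead_expo le h) a" using b(1) divides_trans by blast
    with red[OF h(1) g _ a] have "h = g" by auto
    with h(2) b(1) show "b = a" by (auto simp: a_def intro: divides_antisym)
  qed
  with nonstd have leads: "a \<in> leads" by (auto simp: leads_def)
  have key_nf: "t = normal_form s"
    if "t \<in> Poly_Mapping.keys g" "t \<noteq> a" "adeg A t = adeg A s" for s t
    using normal_form_eq[OF that(3) tail[OF that(1,2)]] by simp
  have nf_a: "normal_form a \<noteq> a" using leads by (rule leads_normal_form_neq)
  have "g = monom a - monom (normal_form a)"
  proof (rule poly_mapping_eqI)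
    fix t
    have sum0: "fibre_sum A (adeg A t) g = 0" using \<open>g \<in> toric_ideal A\<close> by (rule fibre_sum_toric_ideal)
    consider "t = a" | "t = normal_form a" | "t \<notin> Poly_Mapping.keys g" "t \<noteq> a" "t \<noteq> normal_form a"
      | "t \<in> Poly_Mapping.keys g" "t \<noteq> a" "adeg A t \<noteq> adeg A a"
      using key_nf by blast
    then show "Poly_Mapping.lookup g t = Poly_Mapping.lookup (monom a - monom (normal_form a)) t"
    proof cases
      case 1
      then show ?thesis using lc nf_a by (simp add: a_def lookup_minus lookup_single when_def)
    next
      case 2
      have "fibre_sum A (adeg A a) g = (\<Sum>s\<in>insert (normal_form a) (Poly_Mapping.keys g).
          if adeg A s = adeg A a then Poly_Mapping.lookup g s else 0)"
        by (rule fibre_sum_superset) auto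
      (* besides a, only the normal form of a can contribute to the fibre of a *)
      also have "\<dots> = (\<Sum>s\<in>{a, normal_form a}. Poly_Mapping.lookup g s)"
        by (rule sum.mono_neutral_cong_right)
          (use key_nf a in \<open>auto simp: adeg_normal_form\<close>)
      finally show ?thesis
        using sum0 2 lc nf_a
        by (simp add: adeg_normal_form a_def lookup_minus lookup_single when_def eq_neg_iff_add_eq_0
            add.commute)
    next
      case 3
      then show ?thesis by (auto simp: in_keys_iff lookup_minus lookup_single when_def)
    next
      case 4
      (* t would be the only monomial of g in its fibre *)
      have "fibre_sum A (adeg A t) g = (\<Sum>s\<in>{t}. Poly_Mapping.lookup g s)"
        unfolding fibre_sum_def
      proof (rule sum.mono_neutral_cong_right)
        show "\<forall>s\<in>Poly_Mapping.keys g - {t}. (if adeg A s = adeg A t then Poly_Mapping.lookup g s else 0) = 0"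
        proof
          fix s assume "s \<in> Poly_Mapping.keys g - {t}"
          then have "s \<in> Poly_Mapping.keys g" "s \<noteq> t" by auto
          then have "adeg A s \<noteq> adeg A t"
            using key_nf[of s t] key_nf[of t t] 4 by metis
          then show "(if adeg A s = adeg A t then Poly_Mapping.lookup g s else 0) = 0" by simp
        qed
      qed (use 4 in auto)
      with sum0 4 show ?thesis by (simp add: in_keys_iff)
    qed
  qed
  with leads show "g \<in> gb" by (auto simp: gb_def)
qed

text \<open>Rewriting with the elements of \<open>gb\<close> descends in the finite fibre.\<close>

lemma monom_diff_normal_form_in_ideal_gen_gb:
  "(monom t - monom (normal_form t) :: ('n, 'k::field) mpoly) \<in> ideal_gen gb"
proof (induction "card {s. adeg A s = adeg A t \<and> le s t}" arbitrary: t rule: less_induct)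
  case less
  show ?case
  proof (cases "standard t")
    case True
    then have "normal_form t = t" by (intro normal_form_eq) auto
    then show ?thesis by (simp add: ideal_gen_zero)
  next
    case False
    then obtain a where a: "a \<in> leads" "divides a t" using nonstandard_divisible_by_lead by blast
    then obtain c where t: "t = c + a" by (auto simp: divides_def add.commute)
    define t' where "t' = c + normal_form a"
    have deg: "adeg A t' = adeg A t" by (simp add: t t'_def adeg_add adeg_normal_form)
    have "le t' t" by (simp add: t t'_def add_left normal_form_le)
    have "t' \<noteq> t" using leads_normal_form_neq[OF a(1)] by (simp add: t t'_def)
    have "{s. adeg A s = adeg A t' \<and> le s t'} \<subset> {s. adeg A s = adeg A t \<and> le s t}"
    proof
      show "{s. adeg A s = adeg A t' \<and> le s t'} \<subseteq> {s. adeg A s = adeg A t \<and> le s t}"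
        using le_trans[OF _ \<open>le t' t\<close>] deg by auto
      have "\<not> le t t'" using \<open>le t' t\<close> \<open>t' \<noteq> t\<close> le_antisym by blast
      then show "{s. adeg A s = adeg A t' \<and> le s t'} \<noteq> {s. adeg A s = adeg A t \<and> le s t}"
        using le_refl[of t] by (auto simp: set_eq_iff intro!: exI[of _ t])
    qed
    moreover have "finite {s. adeg A s = adeg A t \<and> le s t}"
      by (rule finite_subset[OF _ finite_fibre[of "adeg A t"]]) auto
    ultimately have "(monom t' - monom (normal_form t') :: ('n, 'k) mpoly) \<in> ideal_gen gb"
      using less by (meson psubset_card_mono)
    moreover have "normal_form t' = normal_form t"
      by (simp add: normal_form_def deg)
    moreover have "monom c * (monom a - monom (normal_form a)) \<in> ideal_gen (gb :: ('n, 'k) mpoly set)"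
      by (intro ideal_gen_mult ideal_gen_base) (use a(1) in \<open>auto simp: gb_def\<close>)
    then have "monom t - monom t' \<in> ideal_gen (gb :: ('n, 'k) mpoly set)"
      by (simp add: t t'_def right_diff_distrib monom_mult)
    ultimately show ?thesis using ideal_gen_add by force
  qed
qed

lemma ideal_gen_gb: "ideal_gen (gb :: ('n, 'k::field) mpoly set) = toric_ideal A"
proof
  show "ideal_gen (gb :: ('n, 'k) mpoly set) \<subseteq> toric_ideal A"
    unfolding toric_ideal_def
    by (rule ideal_gen_subset) (use gb_subset in \<open>simp add: toric_ideal_def\<close>)
  show "toric_ideal A \<subseteq> ideal_gen (gb :: ('n, 'k) mpoly set)"
    unfolding toric_ideal_def
  proof (rule ideal_gen_subset, clarify)
    fix u assume "u \<in> int_kernel A"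
    then have "normal_form (pos_part u) = normal_form (pos_part (- u))"
      by (simp add: normal_form_def adeg_pos_part)
    then show "kernel_binomial u \<in> ideal_gen (gb :: ('n, 'k) mpoly set)"
      using ideal_gen_diff[OF monom_diff_normal_form_in_ideal_gen_gb[of "pos_part u"]
        monom_diff_normal_form_in_ideal_gen_gb[of "pos_part (- u)"]]
      by (simp add: kernel_binomial_def)
  qed
qed

text \<open>A common variable of the two monomials could be cancelled, which would leave a smaller
  nonstandard exponent.\<close>

lemma leads_pos_part:
  assumes "a \<in> leads"
  defines "u \<equiv> expo_vec a - expo_vec (normal_form a)"
  shows "a = pos_part u" "normal_form a = pos_part (- u)" "u \<in> int_kernel A" "u \<noteq> 0"
proof -
  show "u \<in> int_kernel A"
    using adeg_normal_form[of a] by (simp add: u_def flip: adeg_eq_iff)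
  show "u \<noteq> 0" using leads_normal_form_neq[OF assms(1)] by (auto simp: u_def)
  obtain c where c: "a = c + pos_part u" "normal_form a = c + pos_part (- u)"
    using expo_split[of a "normal_form a"] unfolding u_def by blast
  have "le (pos_part (- u)) (pos_part u)" using c normal_form_le[of a] add_left_iff by metis
  with \<open>u \<in> int_kernel A\<close> \<open>u \<noteq> 0\<close> have "\<not> standard (pos_part u)"
    using nonstandard_iff adeg_pos_part pos_part_neq by metis
  moreover have "divides (pos_part u) a" using c(1) by (auto simp: divides_def add.commute)
  ultimately show "a = pos_part u" using assms(1) by (auto simp: leads_def)
  with c show "normal_form a = pos_part (- u)" by simp
qed

end

section \<open>Indispensable binomials and two-element fibres\<close>

text \<open>For \<open>u\<close> in the kernel, \<open>x \<mapsto> u\<^sup>+ - x\<close> maps the kernel vectors \<open>x \<le> u\<^sup>+\<close> onto the fibre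
  of \<open>u\<^sup>+\<close>; so \<open>thin\<close> says that this fibre is \<open>{u\<^sup>+, u\<^sup>-}\<close>.\<close>

definition thin :: "int ^ 'n::finite ^ 'm \<Rightarrow> int ^ 'n \<Rightarrow> bool" where
  "thin A u \<longleftrightarrow> (\<forall>x\<in>int_kernel A. (\<forall>i. x $ i \<le> max 0 (u $ i)) \<longrightarrow> x = 0 \<or> x = u)"

lemma expo_vec_of_nonneg: "(\<And>i. 0 \<le> v $ i) \<Longrightarrow> expo_vec (pos_part v) = v"
  by (simp add: vec_eq_iff)

lemma thin_iff_fibre:
  assumes "u \<in> int_kernel A"
  shows "thin A u \<longleftrightarrow> (\<forall>s. adeg A s = adeg A (pos_part u) \<longrightarrow> s = pos_part u \<or> s = pos_part (- u))"
    (is "_ \<longleftrightarrow> ?R")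
proof
  assume thin: "thin A u"
  show ?R
  proof (intro allI impI)
    fix s assume "adeg A s = adeg A (pos_part u)"
    then have "expo_vec (pos_part u) - expo_vec s \<in> int_kernel A" by (simp flip: adeg_eq_iff)
    moreover have "(expo_vec (pos_part u) - expo_vec s) $ i \<le> max 0 (u $ i)" for i by simp
    ultimately have "expo_vec (pos_part u) - expo_vec s = 0 \<or> expo_vec (pos_part u) - expo_vec s = u"
      using thin unfolding thin_def by blast
    then show "s = pos_part u \<or> s = pos_part (- u)"
    proof
      assume "expo_vec (pos_part u) - expo_vec s = u"
      then have "expo_vec s = expo_vec (pos_part (- u))"
        using expo_vec_pos_part_diff[of u] by (simp add: algebra_simps)
      then show ?thesis by simp
    qed simp
  qed
next
  assume R: ?R
  show "thin A u"
    unfolding thin_def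
  proof (intro ballI impI)
    fix x assume x: "x \<in> int_kernel A" "\<forall>i. x $ i \<le> max 0 (u $ i)"
    define s where "s = pos_part (expo_vec (pos_part u) - x)"
    have s: "expo_vec s = expo_vec (pos_part u) - x"
      unfolding s_def
    proof (rule expo_vec_of_nonneg)
      show "0 \<le> (expo_vec (pos_part u) - x) $ i" for i
        using x(2)[rule_format, of i] by (simp add: max_def split: if_splits)
    qed
    then have "adeg A s = adeg A (pos_part u)"
      using int_kernel_uminus[OF x(1)] by (simp add: adeg_eq_iff)
    with R have "expo_vec s = expo_vec (pos_part u) \<or> expo_vec s = expo_vec (pos_part (- u))" by auto
    then show "x = 0 \<or> x = u"
      using expo_vec_pos_part_diff[of u] by (auto simp: s algebra_simps)
  qed
qed

lemma thin_uminus: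
  assumes "thin A u" "u \<in> int_kernel A"
  shows "thin A (- u)"
  unfolding thin_def
proof (intro ballI impI)
  fix x assume x: "x \<in> int_kernel A" "\<forall>i. x $ i \<le> max 0 ((- u) $ i)"
  have "(x + u) $ i \<le> max 0 (u $ i)" for i
    using x(2)[rule_format, of i] by (simp add: max_def split: if_splits)
  then have "x + u = 0 \<or> x + u = u"
    using assms int_kernel_add[OF x(1) assms(2)] unfolding thin_def by blast
  then show "x = 0 \<or> x = - u" by (auto simp: eq_neg_iff_add_eq_0)
qed

lemma common_divisor_pos_part:
  assumes "divides c (pos_part u)" "divides c (pos_part (- u))"
  shows "c = 0"
proof (rule poly_mapping_eqI)
  fix i
  show "Poly_Mapping.lookup c i = Poly_Mapping.lookup 0 i"
    using assms[unfolded divides_iff, rule_format, of i] by (cases "0 \<le> u $ i") auto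
qed

lemma pos_part_eq_0_iff: "pos_part u = 0 \<longleftrightarrow> (\<forall>i. u $ i \<le> 0)"
  by (auto simp: poly_mapping_eq_iff fun_eq_iff)

lemma keys_kernel_binomial:
  "u \<noteq> 0 \<Longrightarrow> Poly_Mapping.keys (kernel_binomial u :: ('n::finite, 'k::comm_ring_1) mpoly)
     = {pos_part u, pos_part (- u)}"
  by (simp add: kernel_binomial_def keys_binomial pos_part_neq)

lemma kernel_binomial_neq_0: "u \<noteq> 0 \<Longrightarrow> (kernel_binomial u :: ('n::finite, 'k::comm_ring_1) mpoly) \<noteq> 0"
  by (metis keys_kernel_binomial insert_not_empty keys_zero)

lemma is_binomial_kernel_binomial: "u \<noteq> 0 \<Longrightarrow> is_binomial (kernel_binomial u)"
  unfolding is_binomial_def kernel_binomial_def using pos_part_neq by blast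

lemma kernel_binomial_in_toric_ideal: "u \<in> int_kernel A \<Longrightarrow> kernel_binomial u \<in> toric_ideal A"
  by (simp add: kernel_binomial_def binomial_in_toric_ideal adeg_pos_part)

text \<open>No monomial multiple of another binomial of the ideal involves the monomials of a
  two-element fibre, so the coefficient at \<open>u\<^sup>+\<close> vanishes on the ideal that the others generate.\<close>

lemma thin_in_generating_set:
  fixes S :: "('n::finite, 'k::field) mpoly set"
  assumes u: "u \<in> int_kernel A" "u \<noteq> 0" "thin A u"
    and S: "S \<subseteq> toric_ideal A" "\<And>g. g \<in> S \<Longrightarrow> is_binomial g"
    and gen: "kernel_binomial u \<in> ideal_gen S"
  shows "kernel_binomial u \<in> S \<or> - kernel_binomial u \<in> S"
proof (rule ccontr)
  assume no: "\<not> ?thesis"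
  let ?J = "{f :: ('n, 'k) mpoly. \<forall>r. Poly_Mapping.lookup (r * f) (pos_part u) = 0}"
  have no_div: "\<not> divides a (pos_part u)"
    if h: "monom a - monom b \<in> S \<or> monom b - monom a \<in> S" and ab: "a \<noteq> b" for a b
  proof
    assume "divides a (pos_part u)"
    then obtain c where c: "pos_part u = c + a" by (auto simp: divides_def add.commute)
    have "adeg A a = adeg A b"
      using h ab S(1) binomial_in_toric_ideal_iff[where ?'k = 'k] by (metis subsetD)
    then have "adeg A (c + b) = adeg A (pos_part u)" by (simp add: c adeg_add)
    moreover have "c + b \<noteq> pos_part u" using ab by (simp add: c)
    ultimately have c': "pos_part (- u) = c + b" using u thin_iff_fibre by metis
    have "c = 0"
      by (rule common_divisor_pos_part[of _ u]) (auto simp: c c' divides_def)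
    then have "kernel_binomial u = (monom a - monom b :: ('n, 'k) mpoly)"
      using c c' by (simp add: kernel_binomial_def)
    with no h show False by auto
  qed
  have "S \<subseteq> ?J"
  proof (intro subsetI CollectI allI)
    fix h r :: "('n, 'k) mpoly" assume h: "h \<in> S"
    then obtain a b where ab: "a \<noteq> b" "h = monom a - monom b" 
      using S(2)[OF h] unfolding is_binomial_def by blast
    then have "\<not> divides a (pos_part u)" "\<not> divides b (pos_part u)"
      using no_div[of a b] no_div[of b a] h by auto
    then have "pos_part u \<notin> Poly_Mapping.keys (r * h)"
      using keys_mult[of r h] ab by (auto simp: keys_binomial divides_def add.commute)
    then show "Poly_Mapping.lookup (r * h) (pos_part u) = 0" by (simp add: in_keys_iff)
  qed
  then have "ideal_gen S \<subseteq> ?J"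
    by (rule ideal_gen_minimal) (auto simp: distrib_left lookup_add simp flip: mult.assoc)
  with gen have "Poly_Mapping.lookup (1 * kernel_binomial u :: ('n, 'k) mpoly) (pos_part u) = 0" by blast
  then have "pos_part u \<notin> Poly_Mapping.keys (kernel_binomial u :: ('n, 'k) mpoly)"
    by (simp add: in_keys_iff)
  with u show False by (simp add: keys_kernel_binomial)
qed

lemma ex_minimal_generating_subset:
  assumes "finite S"
  obtains T where "T \<subseteq> S" "minimal_generating_set (ideal_gen S) T"
proof -
  have "\<exists>T\<subseteq>S. minimal_generating_set (ideal_gen S) T"
    using assms
  proof (induction rule: finite_psubset_induct)
    case (psubset S)
    show ?case
    proof (cases "\<exists>T. T \<subset> S \<and> ideal_gen T = ideal_gen S")
      case True
      then obtain T where "T \<subset> S" "ideal_gen T = ideal_gen S" by blast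
      with psubset.IH[of T] show ?thesis by auto
    qed (auto simp: minimal_generating_set_def)
  qed
  with that show ?thesis by blast
qed

context pointed_kernel
begin

text \<open>The reduced Groebner basis of any order will do; weight \<open>0\<close> gives the lexicographic one.\<close>

lemma ex_finite_binomial_generating_set:
  obtains G :: "('n, 'k::field) mpoly set"
  where "finite G" "\<And>g. g \<in> G \<Longrightarrow> is_binomial g" "ideal_gen G = toric_ideal A"
proof -
  interpret pointed_kernel_order A "weight_le (\<lambda>_. 0)"
    by unfold_locales (simp add: monomial_order_weight_le)
  have "is_binomial g" if g: "g \<in> (gb :: ('n, 'k) mpoly set)" for g
  proof -
    obtain a where "a \<in> leads" "g = monom a - monom (normal_form a)"
      using g by (auto simp: gb_def)
    with leads_normal_form_neq[of a] show ?thesis unfolding is_binomial_def by metis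
  qed
  then show ?thesis
    by (intro that[of gb] ideal_gen_gb) (auto simp: gb_def finite_leads)
qed

text \<open>If the fibre has a third element \<open>s\<close>, the binomial is the sum of \<open>x\<^bsup>u+\<^esup> - x\<^bsup>s\<^esup>\<close> and
  \<open>x\<^bsup>s\<^esup> - x\<^bsup>u-\<^esup>\<close> and can be traded for them in any finite system of generators.\<close>

lemma indispensable_iff_thin:
  assumes u: "u \<in> int_kernel A" "u \<noteq> 0"
  shows "indispensable (toric_ideal A) (kernel_binomial u :: ('n, 'k::field) mpoly) \<longleftrightarrow> thin A u"
proof
  assume "thin A u"
  have "kernel_binomial u \<in> S \<or> - kernel_binomial u \<in> S"
    if "minimal_generating_set (toric_ideal A) S" "\<forall>g\<in>S. is_binomial g" for S :: "('n, 'k) mpoly set"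
  proof (rule thin_in_generating_set)
    have gen: "ideal_gen S = toric_ideal A" using that(1) by (simp add: minimal_generating_set_def)
    show "S \<subseteq> toric_ideal A" unfolding gen[symmetric] by (auto intro: ideal_gen_base)
    show "kernel_binomial u \<in> ideal_gen S" using u by (simp add: gen kernel_binomial_in_toric_ideal)
  qed (use that u \<open>thin A u\<close> in auto)
  then show "indispensable (toric_ideal A) (kernel_binomial u :: ('n, 'k) mpoly)"
    using u by (simp add: indispensable_def is_binomial_kernel_binomial kernel_binomial_in_toric_ideal)
next
  let ?f = "kernel_binomial u :: ('n, 'k) mpoly"
  let ?I = "toric_ideal A :: ('n, 'k) mpoly set"
  assume ind: "indispensable ?I ?f"
  show "thin A u"
  proof (rule ccontr)
    assume "\<not> thin A u"
    then obtain s where s: "adeg A s = adeg A (pos_part u)" "s \<noteq> pos_part u" "s \<noteq> pos_part (- u)"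
      using thin_iff_fibre[OF u(1)] by blast
    obtain G :: "('n, 'k) mpoly set" where G: "finite G" "\<And>g. g \<in> G \<Longrightarrow> is_binomial g" "ideal_gen G = ?I"
      using ex_finite_binomial_generating_set[where 'k = 'k] by metis
    let ?g = "monom (pos_part u) - monom s :: ('n, 'k) mpoly"
    let ?h = "monom s - monom (pos_part (- u)) :: ('n, 'k) mpoly"
    let ?S = "insert ?g (insert ?h (G - {?f, - ?f}))"
    have gh: "?g \<in> ?I" "?h \<in> ?I" "?f = ?g + ?h"
      using s(1) adeg_pos_part[OF u(1)]
      by (simp_all add: binomial_in_toric_ideal kernel_binomial_def)
    have "?f \<in> ideal_gen ?S"
      unfolding gh(3) by (intro ideal_gen_add ideal_gen_base) auto
    then have "G \<subseteq> ideal_gen ?S"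
      using ideal_gen_neg[of ?f ?S] by (auto intro: ideal_gen_base)
    moreover have "?S \<subseteq> ideal_gen G"
      using gh(1,2) by (auto simp flip: G(3) intro: ideal_gen_base)
    ultimately have gen: "ideal_gen ?S = ?I"
      using ideal_gen_subset G(3) by blast
    obtain T where T: "T \<subseteq> ?S" "minimal_generating_set ?I T"
      using ex_minimal_generating_subset[of ?S] G(1) gen by (metis finite_Diff finite_insert)
    have "?f \<noteq> ?g" "?f \<noteq> ?h" "- ?f \<noteq> ?g" "- ?f \<noteq> ?h"
    proof -
      have "Poly_Mapping.keys ?g = {pos_part u, s}" "Poly_Mapping.keys ?h = {s, pos_part (- u)}"
        "Poly_Mapping.keys ?f = {pos_part u, pos_part (- u)}"
        "Poly_Mapping.keys (- ?f) = {pos_part u, pos_part (- u)}"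
        using s(2,3) u(2) keys_kernel_binomial[of "- u", where ?'k = 'k]
        by (auto simp: keys_binomial keys_kernel_binomial kernel_binomial_uminus)
      with s(2,3) show "?f \<noteq> ?g" "?f \<noteq> ?h" "- ?f \<noteq> ?g" "- ?f \<noteq> ?h"
        by (metis doubleton_eq_iff)+
    qed
    with T(1) have "?f \<notin> T" "- ?f \<notin> T" by auto
    moreover have "is_binomial ?g" "is_binomial ?h" using s(2,3) unfolding is_binomial_def by metis+
    then have "\<forall>g\<in>T. is_binomial g" using T(1) G(2) by blast
    ultimately show False using ind T(2) by (auto simp: indispensable_def)
  qed
qed

end


section \<open>Primitive vectors and irreducible binomials\<close>

text \<open>By Bezout, this is the condition that the coordinates have no common divisor; stated with
  the linear form because that certificate is what divisibility and width arguments need.\<close>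

definition primitive_vec :: "int ^ 'n::finite \<Rightarrow> bool" where
  "primitive_vec u \<longleftrightarrow> (\<exists>\<omega>. (\<Sum>i\<in>UNIV. \<omega> i * u $ i) = 1)"

text \<open>The least positive value of an integer linear form at \<open>u\<close> divides every coordinate
  of \<open>u\<close>.\<close>

lemma primitive_vec_multiple:
  fixes u :: "int ^ 'n::finite"
  assumes "u \<noteq> 0"
  obtains d v where "0 < d" "u = d *s v" "primitive_vec v"
proof -
  let ?dot = "\<lambda>\<omega>. \<Sum>i\<in>UNIV. \<omega> i * u $ i"
  let ?P = "\<lambda>k. 0 < k \<and> (\<exists>\<omega>. ?dot \<omega> = int k)"
  obtain j where j: "u $ j \<noteq> 0" using assms by (auto simp: vec_eq_iff)
  have sq: "?dot (\<lambda>i. u $ i) > 0"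
    by (rule sum_pos2[of _ j]) (use j in \<open>auto simp: zero_less_mult_iff\<close>)
  then have "?P (nat (?dot (\<lambda>i. u $ i)))" by (intro conjI exI[of _ "\<lambda>i. u $ i"]) auto
  then have "?P (LEAST k. ?P k)" by (rule LeastI)
  then obtain \<omega> where d: "0 < (LEAST k. ?P k)" "?dot \<omega> = int (LEAST k. ?P k)" by blast
  define d where "d = int (LEAST k. ?P k)"
  have dvd: "d dvd u $ i" for i
  proof (rule ccontr)
    assume "\<not> d dvd u $ i"
    then have "u $ i mod d \<noteq> 0" by (simp add: mod_eq_0_iff_dvd)
    moreover have "0 \<le> u $ i mod d" using d(1) by (simp add: d_def)
    ultimately have pos: "0 < u $ i mod d" by linarith
    (* the linear form whose value at u is the remainder of u_i modulo d *)
    let ?\<rho> = "\<lambda>j. (if j = i then 1 else 0) - (u $ i div d) * \<omega> j"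
    have "?dot ?\<rho> = u $ i - (u $ i div d) * ?dot \<omega>"
      by (simp add: left_diff_distrib sum_subtractf sum_distrib_left if_distrib[of "\<lambda>x. x * _"]
          mult.assoc cong: if_cong)
    also have "\<dots> = u $ i mod d"
      using d(2) by (simp add: minus_div_mult_eq_mod flip: d_def)
    finally have "?P (nat (u $ i mod d))" using pos by auto
    then have "(LEAST k. ?P k) \<le> nat (u $ i mod d)" by (rule Least_le)
    then have "d \<le> u $ i mod d" using pos by (simp add: d_def)
    moreover have "u $ i mod d < d" using d(1) by (simp add: d_def)
    ultimately show False by simp
  qed
  define v where "v = (\<chi> i. u $ i div d)"
  have u: "u = d *s v" using dvd by (simp add: vec_eq_iff v_def)
  have "d * (\<Sum>i\<in>UNIV. \<omega> i * v $ i) = d * 1"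
    using d(2) unfolding d_def[symmetric] by (subst (asm) u) (simp add: sum_distrib_left mult.left_commute)
  then have "primitive_vec v" using d(1) by (auto simp: primitive_vec_def d_def)
  moreover have "0 < d" using d(1) by (simp add: d_def)
  ultimately show ?thesis using that u by blast
qed

lemma constant_free_times:
  fixes f r :: "('n, 'k::comm_ring_1) mpoly"
  assumes "0 \<notin> Poly_Mapping.keys f"
  shows "0 \<notin> Poly_Mapping.keys (r * f)"
proof
  assume "0 \<in> Poly_Mapping.keys (r * f)"
  then obtain a b where "a + b = 0" "b \<in> Poly_Mapping.keys f" using keys_mult[of r f] by force
  moreover from \<open>a + b = 0\<close> have "Poly_Mapping.lookup a i + Poly_Mapping.lookup b i = 0" for i
    by (simp flip: lookup_add)
  then have "b = 0" by (intro poly_mapping_eqI) simp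
  ultimately show False using assms by simp
qed

lemma constant_free_not_unit:
  fixes f :: "('n, 'k::comm_ring_1) mpoly"
  assumes "0 \<notin> Poly_Mapping.keys f"
  shows "\<not> f dvd 1"
proof
  assume "f dvd 1"
  then obtain r where "1 = r * f" by (auto simp: dvd_def mult.commute)
  with constant_free_times[OF assms, of r] show False by (metis keys_one singletonI)
qed

text \<open>The width of the Newton polytope of \<open>f\<close> in direction \<open>\<omega>\<close>: the leading exponents for \<open>\<omega>\<close> and
  \<open>-\<omega>\<close> have the greatest and the least \<open>\<omega>\<close>-weight.\<close>

definition width :: "('n::finite \<Rightarrow> int) \<Rightarrow> ('n, 'k::field) mpoly \<Rightarrow> int" where
  "width \<omega> f = weight \<omega> (lead_expo (weight_le \<omega>) f) -
     weight \<omega> (lead_expo (weight_le (\<lambda>i. - \<omega> i)) f)"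

lemma width_mult: "f \<noteq> 0 \<Longrightarrow> g \<noteq> 0 \<Longrightarrow> width \<omega> (f * g) = width \<omega> f + width \<omega> g"
  by (simp add: width_def additive_order.lead_expo_mult[OF additive_order_weight_le] weight_add)

lemma weight_diff_le_width:
  assumes "s \<in> Poly_Mapping.keys f" "t \<in> Poly_Mapping.keys f"
  shows "weight \<omega> s - weight \<omega> t \<le> width \<omega> f"
proof -
  have "f \<noteq> 0" using assms by auto
  then have "weight_le \<omega> s (lead_expo (weight_le \<omega>) f)"
    "weight_le (\<lambda>i. - \<omega> i) t (lead_expo (weight_le (\<lambda>i. - \<omega> i)) f)"
    using assms additive_order.le_lead_expo[OF additive_order_weight_le] by auto
  then show ?thesis by (auto simp: weight_le_def width_def weight_uminus)
qed

lemma width_nonneg: "f \<noteq> 0 \<Longrightarrow> 0 \<le> width \<omega> f"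
  using additive_order.lead_expo_in_keys[OF additive_order_weight_le, of f \<omega>]
    weight_diff_le_width[of "lead_expo (weight_le \<omega>) f" f "lead_expo (weight_le \<omega>) f"]
  by simp

lemma weight_diff: "weight \<omega> s - weight \<omega> t = (\<Sum>i\<in>UNIV. \<omega> i * (expo_vec s - expo_vec t) $ i)"
  by (simp add: weight_def sum_subtractf right_diff_distrib)

lemma width_kernel_binomial:
  assumes "u \<noteq> 0"
  shows "width \<omega> (kernel_binomial u :: ('n::finite, 'k::field) mpoly) \<le> \<bar>\<Sum>i\<in>UNIV. \<omega> i * u $ i\<bar>"
proof -
  let ?f = "kernel_binomial u :: ('n, 'k) mpoly"
  have keys: "lead_expo (weight_le \<rho>) ?f \<in> {pos_part u, pos_part (- u)}" for \<rho>
    using additive_order.lead_expo_in_keys[OF additive_order_weight_le kernel_binomial_neq_0[OF assms]]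
    by (simp add: keys_kernel_binomial assms)
  have "weight \<omega> (pos_part u) - weight \<omega> (pos_part (- u)) = (\<Sum>i\<in>UNIV. \<omega> i * u $ i)"
    by (simp only: weight_diff expo_vec_pos_part_diff)
  with keys[of \<omega>] keys[of "\<lambda>i. - \<omega> i"] show ?thesis by (auto simp: width_def)
qed

text \<open>Widths are additive under multiplication. The Newton polytope of the binomial is the segment
  from \<open>u\<^sup>-\<close> to \<open>u\<^sup>+\<close>: it has width \<open>1\<close> in some direction \<open>\<omega>\<close> and width \<open>0\<close> in all directions
  orthogonal to \<open>u\<close>. So one of two factors has width \<open>0\<close> in directions that span the space and is
  a monomial.\<close>

lemma irreducible_kernel_binomial:
  fixes u :: "int ^ 'n::finite"
  assumes prim: "primitive_vec u" and nc: "pos_part u \<noteq> 0" "pos_part (- u) \<noteq> 0"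
  shows "irreducible (kernel_binomial u :: ('n, 'k::field) mpoly)"
proof (rule irreducibleI)
  let ?f = "kernel_binomial u :: ('n, 'k) mpoly"
  have u: "u \<noteq> 0" using prim by (auto simp: primitive_vec_def)
  show "?f \<noteq> 0" using u by (rule kernel_binomial_neq_0)
  show "\<not> ?f dvd 1"
    by (rule constant_free_not_unit) (simp add: keys_kernel_binomial u nc[symmetric])
  obtain \<omega> where \<omega>: "(\<Sum>i\<in>UNIV. \<omega> i * u $ i) = 1" using prim by (auto simp: primitive_vec_def)
  have unit: "g dvd 1" if f: "?f = g * h" and w: "width \<omega> g \<le> 0" for g h
  proof -
    have gh: "g \<noteq> 0" "h \<noteq> 0" using f \<open>?f \<noteq> 0\<close> by auto
    have single: "s = t" if st: "s \<in> Poly_Mapping.keys g" "t \<in> Poly_Mapping.keys g" for s t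
    proof -
      let ?x = "expo_vec s - expo_vec t"
      have 1: "(\<Sum>i\<in>UNIV. \<rho> i * ?x $ i) = 0" if "width \<rho> g \<le> 0" for \<rho>
        using weight_diff_le_width[of s g t \<rho>] weight_diff_le_width[of t g s \<rho>] st that
        unfolding weight_diff[symmetric] by simp
      have "?x $ i = 0" for i
      proof -
        (* the i-th coordinate form, made orthogonal to u by means of the form with value 1 at u *)
        let ?\<rho> = "\<lambda>j. (if j = i then 1 else 0) - u $ i * \<omega> j"
        have dot: "(\<Sum>j\<in>UNIV. ?\<rho> j * y $ j) = y $ i - u $ i * (\<Sum>j\<in>UNIV. \<omega> j * y $ j)" for y
          by (simp add: left_diff_distrib sum_subtractf sum_distrib_left if_distrib[of "\<lambda>x. x * _"]
              mult.assoc cong: if_cong)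
        have "width ?\<rho> g + width ?\<rho> h \<le> 0"
          using width_kernel_binomial[OF u, of ?\<rho>, where ?'k = 'k] dot[of u] \<omega>
          by (simp add: f width_mult gh)
        with width_nonneg[OF gh(2), of ?\<rho>] have "width ?\<rho> g \<le> 0" by simp
        from 1[OF this] 1[OF w] dot[of ?x] show ?thesis by simp
      qed
      then have "expo_vec s = expo_vec t" by (simp add: vec_eq_iff)
      then show ?thesis by simp
    qed
    obtain s where s: "s \<in> Poly_Mapping.keys g" using gh(1) by (metis all_not_in_conv keys_eq_empty)
    define c where "c = Poly_Mapping.lookup g s"
    have g: "g = Poly_Mapping.single s c"
    proof (rule poly_mapping_eqI)
      fix t
      show "Poly_Mapping.lookup g t = Poly_Mapping.lookup (Poly_Mapping.single s c) t"
        using single[OF s, of t] by (auto simp: lookup_single when_def c_def in_keys_iff)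
    qed
    have "{pos_part u, pos_part (- u)} \<subseteq> (+) s ` Poly_Mapping.keys h"
      using keys_single_times[of s c h] by (simp add: keys_kernel_binomial u flip: f g)
    then have "s = 0" by (intro common_divisor_pos_part[of _ u]) (auto simp: divides_def)
    moreover have "c \<noteq> 0" using s by (simp add: c_def in_keys_iff)
    ultimately have "g * Poly_Mapping.single 0 (inverse c) = 1"
      by (simp add: g mult_single)
    then show ?thesis by (metis dvdI)
  qed
  fix g h assume f: "?f = g * h"
  then have gh: "g \<noteq> 0" "h \<noteq> 0" using \<open>?f \<noteq> 0\<close> by auto
  have "width \<omega> g + width \<omega> h \<le> 1"
    using width_kernel_binomial[OF u, of \<omega>, where ?'k = 'k] \<omega> by (simp add: f width_mult gh)
  then have "width \<omega> g \<le> 0 \<or> width \<omega> h \<le> 0" by linarith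
  then show "g dvd 1 \<or> h dvd 1" using unit[of g h] unit[of h g] f by (auto simp: mult.commute)
qed

lemma monom_pos_part_scale:
  "monom (pos_part (int d *s v)) = (monom (pos_part v) ^ d :: ('n::finite, 'k::comm_ring_1) mpoly)"
proof (induction d)
  case 0
  have "pos_part (0 *s v) = 0" by (rule poly_mapping_eqI) simp
  then show ?case by simp
next
  case (Suc d)
  have "pos_part (int (Suc d) *s v) = pos_part v + pos_part (int d *s v)"
  proof (rule poly_mapping_eqI)
    fix i
    show "Poly_Mapping.lookup (pos_part (int (Suc d) *s v)) i =
        Poly_Mapping.lookup (pos_part v + pos_part (int d *s v)) i"
    proof (cases "0 \<le> v $ i")
      case True
      then show ?thesis by (simp add: lookup_add distrib_right nat_add_distrib)
    next
      case False
      then have "int d * v $ i \<le> 0" "(1 + int d) * v $ i \<le> 0" by (simp_all add: mult_nonneg_nonpos)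
      with False show ?thesis by (simp add: lookup_add)
    qed
  qed
  then show ?case by (simp flip: monom_mult Suc.IH)
qed

text \<open>If \<open>u = dv\<close> with \<open>d \<ge> 2\<close>, then \<open>x\<^bsup>v+\<^esup> - x\<^bsup>v-\<^esup>\<close> divides the binomial of \<open>u\<close>; neither it nor the
  cofactor has a constant term, so both are nonunits.\<close>

lemma primitive_vec_if_irreducible:
  fixes u :: "int ^ 'n::finite"
  assumes irr: "irreducible (kernel_binomial u :: ('n, 'k::field) mpoly)"
    and nc: "pos_part u \<noteq> 0" "pos_part (- u) \<noteq> 0"
  shows "primitive_vec u"
proof (rule ccontr)
  assume np: "\<not> primitive_vec u"
  have "u \<noteq> 0" using irr by (auto simp: kernel_binomial_def)
  then obtain d' v where d': "0 < d'" "u = d' *s v" "primitive_vec v" by (rule primitive_vec_multiple)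
  with np have "d' \<noteq> 1" by auto
  define d where "d = nat d'"
  have d: "d' = int d" "2 \<le> d" using d'(1) \<open>d' \<noteq> 1\<close> by (auto simp: d_def)
  let ?X = "monom (pos_part v) :: ('n, 'k) mpoly" and ?Y = "monom (pos_part (- v)) :: ('n, 'k) mpoly"
  have "- u = int d *s (- v)" by (simp add: d'(2) d(1) vec_eq_iff)
  then have "kernel_binomial u = ?X ^ d - ?Y ^ d"
    unfolding kernel_binomial_def by (simp only: d'(2) d(1) monom_pos_part_scale)
  then have f: "kernel_binomial u = (?X - ?Y) * (\<Sum>i<d. ?Y ^ (d - Suc i) * ?X ^ i)"
    by (simp only: power_diff_sumr2)
  have "pos_part v \<noteq> 0" "pos_part (- v) \<noteq> 0"
    using nc d'(1) by (simp_all add: pos_part_eq_0_iff d'(2) mult_le_0_iff zero_le_mult_iff)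
  then have X: "0 \<notin> Poly_Mapping.keys ?X" "0 \<notin> Poly_Mapping.keys ?Y" by auto
  have "0 \<notin> Poly_Mapping.keys (?X - ?Y)" 
    using X unfolding in_keys_iff by (simp add: lookup_minus)
  moreover have "0 \<notin> Poly_Mapping.keys (?Y ^ (d - Suc i) * ?X ^ i)" if "i < d" for i
  proof (cases i)
    case 0
    with d(2) obtain k where "d - Suc i = Suc k" by (metis Suc_diff_Suc Suc_le_lessD numeral_2_eq_2)
    then have "?Y ^ (d - Suc i) * ?X ^ i = ?Y ^ k * ?Y" by (simp add: 0 mult.commute)
    then show ?thesis using constant_free_times X(2) by metis
  next
    case (Suc k)
    then have "?Y ^ (d - Suc i) * ?X ^ i = (?Y ^ (d - Suc i) * ?X ^ k) * ?X"
      by (simp add: mult.commute mult.left_commute)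
    then show ?thesis using constant_free_times X(1) by metis
  qed
  then have "0 \<notin> Poly_Mapping.keys (\<Sum>i<d. ?Y ^ (d - Suc i) * ?X ^ i)"
    by (simp add: in_keys_iff lookup_sum)
  ultimately show False
    using irreducibleD[OF irr f] constant_free_not_unit by blast
qed

section \<open>Conformal decompositions in a kernel of rank two\<close>

text \<open>\<open>w\<close> lies in the smallest face of an orthant that contains \<open>z\<close>; in particular it vanishes where
  \<open>z\<close> does.\<close>

definition sign_compatible :: "int ^ 'n \<Rightarrow> int ^ 'n \<Rightarrow> bool" where
  "sign_compatible z w \<longleftrightarrow> (\<forall>i. (0 \<le> z $ i \<longrightarrow> 0 \<le> w $ i) \<and> (z $ i \<le> 0 \<longrightarrow> w $ i \<le> 0))"

text \<open>The Graver basis: the vectors that are not a sum of two nonzero sign-compatible kernel vectors.\<close>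

definition graver :: "int ^ 'n::finite ^ 'm \<Rightarrow> int ^ 'n \<Rightarrow> bool" where
  "graver A z \<longleftrightarrow> z \<in> int_kernel A \<and> z \<noteq> 0 \<and>
     (\<forall>w\<in>int_kernel A. sign_compatible z w \<and> sign_compatible z (z - w) \<longrightarrow> w = 0 \<or> w = z)"

lemma graverD:
  "graver A z \<Longrightarrow> w \<in> int_kernel A \<Longrightarrow> sign_compatible z w \<Longrightarrow> sign_compatible z (z - w) \<Longrightarrow> w = 0 \<or> w = z"
  by (auto simp: graver_def)

lemma sign_compatible_zero: "sign_compatible z w \<Longrightarrow> z $ i = 0 \<Longrightarrow> w $ i = 0"
  unfolding sign_compatible_def by (metis order_antisym order_refl)

lemma sign_compatible_comb:
  fixes \<alpha> \<beta> :: real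
  assumes "sign_compatible z a" "sign_compatible z b" "0 \<le> \<alpha>" "0 \<le> \<beta>"
    and w: "\<And>i. real_of_int (w $ i) = \<alpha> * a $ i + \<beta> * b $ i"
  shows "sign_compatible z w"
  unfolding sign_compatible_def
proof (intro allI conjI impI)
  fix i
  show "0 \<le> w $ i" if "0 \<le> z $ i"
  proof -
    have "0 \<le> a $ i" "0 \<le> b $ i" using assms that by (auto simp: sign_compatible_def)
    then have "0 \<le> \<alpha> * a $ i + \<beta> * b $ i" using assms by simp
    then show ?thesis by (simp flip: w)
  qed
  show "w $ i \<le> 0" if "z $ i \<le> 0"
  proof -
    have "a $ i \<le> 0" "b $ i \<le> 0" using assms that by (auto simp: sign_compatible_def)
    then have "\<alpha> * a $ i + \<beta> * b $ i \<le> 0"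
      using assms by (simp add: add_nonpos_nonpos mult_nonneg_nonpos)
    then show ?thesis by (simp flip: w)
  qed
qed

definition minor :: "'n \<Rightarrow> 'n \<Rightarrow> int ^ 'n \<Rightarrow> int ^ 'n \<Rightarrow> int" where
  "minor k l a b = a $ k * b $ l - a $ l * b $ k"

text \<open>If \<open>\<alpha> + \<beta> > 1\<close>, the vector \<open>z = \<alpha>a + \<beta>b\<close> lies beyond the segment from \<open>a\<close> to \<open>b\<close> and
  decomposes. Unless \<open>a\<close> or \<open>b\<close> can be split off, the lattice vector \<open>a + b - z\<close> lies in the
  interior of the cone over \<open>a\<close> and \<open>b\<close>, and \<open>z\<close> lies beyond one of the two segments that join
  it to \<open>a\<close> and \<open>b\<close>; the determinant of the new pair is smaller.\<close>

lemma graver_comb_le_1: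
  fixes \<alpha> \<beta> :: real
  assumes z: "graver A z"
    and "a \<in> int_kernel A" "b \<in> int_kernel A" "sign_compatible z a" "sign_compatible z b"
    and "minor k l a b \<noteq> 0" "0 \<le> \<alpha>" "0 \<le> \<beta>"
    and "\<And>i. real_of_int (z $ i) = \<alpha> * a $ i + \<beta> * b $ i"
  shows "\<alpha> + \<beta> \<le> 1"
  using assms(2-)
proof (induction "nat \<bar>minor k l a b\<bar>" arbitrary: a b \<alpha> \<beta> rule: less_induct)
  case less
  note ker = less.prems(1,2) and sc = less.prems(3,4) and m = less.prems(5)
    and nonneg = less.prems(6,7) and zi = less.prems(8)
  have split_off: False
    if c: "c \<in> int_kernel A" "sign_compatible z c" "sign_compatible z d" "minor k l c d \<noteq> 0"
      "1 \<le> \<gamma>" "0 \<le> \<delta>" "1 < \<gamma> + \<delta>" "\<And>i. real_of_int (z $ i) = \<gamma> * c $ i + \<delta> * d $ i" for c d and \<gamma> \<delta> :: real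
  proof -
    have "sign_compatible z (z - c)"
      by (rule sign_compatible_comb[of z c d "\<gamma> - 1" \<delta>]) (use c in \<open>auto simp: algebra_simps\<close>)
    then have "c = 0 \<or> c = z" using graverD[OF z c(1,2)] by blast
    then show False
    proof
      assume "c = z"
      then have eq: "(1 - \<gamma>) * c $ i = \<delta> * d $ i" for i
        using c(8)[of i] by (simp add: algebra_simps)
      have "\<delta> * real_of_int (minor k l c d) = c $ k * (\<delta> * d $ l) - c $ l * (\<delta> * d $ k)"
        by (simp add: minor_def algebra_simps)
      also have "\<dots> = 0" by (simp flip: eq)
      finally have "\<delta> = 0" using c(4) by simp
      with eq c(5,7) have "c $ i = 0" for i by (metis add.right_neutral diff_gt_0_iff_gt
        eq_iff_diff_eq_0 less_irrefl mult_eq_0_iff mult_zero_left of_int_eq_0_iff)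
      with c(4) show False by (simp add: minor_def)
    qed (use c(4) in \<open>simp add: minor_def\<close>)
  qed
  show ?case
  proof (rule ccontr)
    assume "\<not> \<alpha> + \<beta> \<le> 1"
    then have gt: "\<alpha> + \<beta> > 1" by simp
    have "minor k l b a \<noteq> 0" using m by (simp add: minor_def algebra_simps)
    with split_off[of a b \<alpha> \<beta>] split_off[of b a \<beta> \<alpha>] ker sc m nonneg gt zi
    have lt1: "\<alpha> < 1" "\<beta> < 1" by (force simp: add.commute)+
    define w where "w = a + b - z"
    have wi: "real_of_int (w $ i) = (1 - \<alpha>) * a $ i + (1 - \<beta>) * b $ i" for i
      by (simp add: w_def zi algebra_simps)
    have w: "w \<in> int_kernel A" "sign_compatible z w"
    proof -
      show "w \<in> int_kernel A"
        using ker z unfolding w_def by (intro int_kernel_diff int_kernel_add) (auto simp: graver_def)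
      show "sign_compatible z w"
        by (rule sign_compatible_comb[OF sc _ _ wi]) (use lt1 in auto)
    qed
    show False
    proof (cases "\<beta> \<le> \<alpha>")
      case True
      have eq: "real_of_int (minor k l a w) = (1 - \<beta>) * minor k l a b"
        by (simp add: minor_def wi algebra_simps)
      then have "minor k l a w \<noteq> 0" using m lt1 by auto
      moreover have "\<bar>real_of_int (minor k l a w)\<bar> < \<bar>real_of_int (minor k l a b)\<bar>"
        unfolding eq abs_mult using m lt1 gt by (simp add: abs_less_iff)
      then have "\<bar>minor k l a w\<bar> < \<bar>minor k l a b\<bar>" by linarith
      then have "nat \<bar>minor k l a w\<bar> < nat \<bar>minor k l a b\<bar>" using m by simp
      moreover have "real_of_int (z $ i) = (\<alpha> - \<beta>) / (1 - \<beta>) * a $ i + \<beta> / (1 - \<beta>) * w $ i" for i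
      proof -
        have "real_of_int (z $ i) * (1 - \<beta>) = (\<alpha> - \<beta>) * a $ i + \<beta> * w $ i"
          by (simp add: zi wi algebra_simps)
        then have "real_of_int (z $ i) = ((\<alpha> - \<beta>) * a $ i + \<beta> * w $ i) / (1 - \<beta>)"
          using lt1 by (simp add: eq_divide_eq)
        then show ?thesis by (simp add: add_divide_distrib)
      qed
      ultimately have "(\<alpha> - \<beta>) / (1 - \<beta>) + \<beta> / (1 - \<beta>) \<le> 1"
        using less.hyps[of a w "(\<alpha> - \<beta>) / (1 - \<beta>)" "\<beta> / (1 - \<beta>)"] ker sc w True lt1 nonneg by simp
      then have "\<alpha> / (1 - \<beta>) \<le> 1" by (simp flip: add_divide_distrib)
      then show False using lt1 gt by (simp add: divide_le_eq)
    next
      case False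
      have eq: "real_of_int (minor k l w b) = (1 - \<alpha>) * minor k l a b"
        by (simp add: minor_def wi algebra_simps)
      then have "minor k l w b \<noteq> 0" using m lt1 by auto
      moreover have "\<bar>real_of_int (minor k l w b)\<bar> < \<bar>real_of_int (minor k l a b)\<bar>"
        unfolding eq abs_mult using m lt1 gt by (simp add: abs_less_iff)
      then have "\<bar>minor k l w b\<bar> < \<bar>minor k l a b\<bar>" by linarith
      then have "nat \<bar>minor k l w b\<bar> < nat \<bar>minor k l a b\<bar>" using m by simp
      moreover have "real_of_int (z $ i) = \<alpha> / (1 - \<alpha>) * w $ i + (\<beta> - \<alpha>) / (1 - \<alpha>) * b $ i" for i
      proof -
        have "real_of_int (z $ i) * (1 - \<alpha>) = \<alpha> * w $ i + (\<beta> - \<alpha>) * b $ i"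
          by (simp add: zi wi algebra_simps)
        then have "real_of_int (z $ i) = (\<alpha> * w $ i + (\<beta> - \<alpha>) * b $ i) / (1 - \<alpha>)"
          using lt1 by (simp add: eq_divide_eq)
        then show ?thesis by (simp add: add_divide_distrib)
      qed
      ultimately have "\<alpha> / (1 - \<alpha>) + (\<beta> - \<alpha>) / (1 - \<alpha>) \<le> 1"
        using less.hyps[of w b "\<alpha> / (1 - \<alpha>)" "(\<beta> - \<alpha>) / (1 - \<alpha>)"] ker sc w False lt1 nonneg by simp
      then have "\<beta> / (1 - \<alpha>) \<le> 1" by (simp flip: add_divide_distrib)
      then show False using lt1 gt by (simp add: divide_le_eq)
    qed
  qed
qed

text \<open>The region of \<open>a\<close>, given by the inequalities \<open>x \<le> max 0 a\<close>, contains no kernel vectors except \<open>0\<close>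
  and \<open>a\<close>, and likewise for \<open>b\<close>. Suppose that \<open>\<tau> < 0\<close>. As \<open>a\<close> is not in the region of \<open>b\<close>, some coordinate \<open>j\<close> has \<open>a\<^sub>j > max 0 b\<^sub>j\<close>, hence \<open>w\<^sub>j \<le> z\<^sub>j \<le> a\<^sub>j\<close>; as \<open>w\<close> is not in the
  region of \<open>a\<close>, some coordinate \<open>i\<close> has \<open>max 0 a\<^sub>i < w\<^sub>i \<le> z\<^sub>i\<close>, hence \<open>b\<^sub>i > a\<^sub>i\<close>. The bound
  \<open>\<alpha> + \<beta> \<le> 1\<close> enters through \<open>z\<^sub>j \<le> a\<^sub>j\<close> and \<open>b\<^sub>i > a\<^sub>i\<close>. The two coordinates then force opposite signs of
  \<open>\<sigma> + \<tau> - 1\<close>.\<close>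

lemma thin_comb_aux:
  fixes \<alpha> \<beta> \<sigma> \<tau> :: real
  assumes ker: "a \<in> int_kernel A" "b \<in> int_kernel A" "w \<in> int_kernel A"
    and sc: "sign_compatible z a" "sign_compatible z b"
    and thin: "thin A a" "thin A b"
    and m: "minor k l a b \<noteq> 0" and nonneg: "0 \<le> \<alpha>" "0 \<le> \<beta>" "\<alpha> + \<beta> \<le> 1"
    and zi: "\<And>i. real_of_int (z $ i) = \<alpha> * a $ i + \<beta> * b $ i"
    and w_le: "\<And>i. w $ i \<le> max 0 (z $ i)"
    and wi: "\<And>i. real_of_int (w $ i) = \<sigma> * a $ i + \<tau> * b $ i"
  shows "0 \<le> \<tau>"
proof (rule ccontr)
  assume "\<not> 0 \<le> \<tau>"
  then have \<tau>: "\<tau> < 0" by simp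
  have "a \<noteq> 0" "a \<noteq> b" using m by (auto simp: minor_def)
  then obtain j where j: "a $ j > max 0 (b $ j)"
    using thin(2) ker(1) unfolding thin_def by (metis linorder_not_le)
  have indep: "\<tau> * minor k l a b = a $ k * real_of_int (w $ l) - a $ l * real_of_int (w $ k)"
    by (simp add: wi minor_def algebra_simps)
  have "w \<noteq> 0" "w \<noteq> a" using indep m \<tau> by auto
  then obtain i where i: "w $ i > max 0 (a $ i)"
    using thin(1) ker(3) unfolding thin_def by (metis linorder_not_le)
  have "0 < z $ i" using i w_le[of i] by (auto simp: max_def split: if_splits)
  then have i_sign: "0 \<le> a $ i" "0 \<le> b $ i" using sc by (auto simp: sign_compatible_def)
  have "real_of_int (a $ i) < real_of_int (z $ i)"
    using i w_le[of i] \<open>0 < z $ i\<close> by simp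
  then have "a $ i < \<alpha> * a $ i + \<beta> * b $ i" by (simp add: zi)
  moreover have "\<alpha> * a $ i + \<beta> * a $ i \<le> a $ i"
    using mult_right_mono[OF nonneg(3), of "real_of_int (a $ i)"] i_sign by (simp add: distrib_right)
  ultimately have "\<beta> * a $ i < \<beta> * b $ i" by linarith
  then have bi: "real_of_int (a $ i) < real_of_int (b $ i)"
    using nonneg(2) by (simp add: mult_less_cancel_left)
  have "real_of_int (a $ i) < \<sigma> * a $ i + \<tau> * b $ i"
    using i by (simp flip: wi)
  also have "\<dots> < \<sigma> * a $ i + \<tau> * a $ i" using bi \<tau> by simp
  finally have "0 < (\<sigma> + \<tau> - 1) * a $ i" by (simp add: algebra_simps)
  then have 1: "\<sigma> + \<tau> - 1 > 0" using i_sign(1) by (simp add: zero_less_mult_iff)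
  have "0 < z $ j" using j sc(1) unfolding sign_compatible_def by (metis linorder_not_le max.strict_boundedE)
  then have "real_of_int (w $ j) \<le> real_of_int (z $ j)" using w_le[of j] by simp
  then have "real_of_int (w $ j) \<le> \<alpha> * a $ j + \<beta> * b $ j" by (simp add: zi)
  also have "\<dots> \<le> \<alpha> * a $ j + \<beta> * a $ j" using j nonneg(2) by (simp add: mult_left_mono)
  also have "\<dots> \<le> a $ j"
    using mult_right_mono[OF nonneg(3), of "real_of_int (a $ j)"] j by (simp add: distrib_right)
  finally have "\<sigma> * a $ j + \<tau> * b $ j \<le> a $ j" by (simp add: wi)
  moreover have "\<tau> * a $ j < \<tau> * b $ j" using j \<tau> by simp
  ultimately have "(\<sigma> + \<tau> - 1) * a $ j < 0" by (simp add: algebra_simps)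
  moreover have "0 < (\<sigma> + \<tau> - 1) * a $ j" using 1 j by simp
  ultimately show False by simp
qed

lemma sign_compatible_uminus: "sign_compatible z w \<Longrightarrow> sign_compatible (- z) (- w)"
  by (simp add: sign_compatible_def)

text \<open>Write a point of the fibre as \<open>w = \<sigma>a + \<tau>b\<close>. Exchanging \<open>a\<close> and \<open>b\<close>, and passing to \<open>-z\<close> and \<open>w - z\<close>,
  turn the inequality \<open>0 \<le> \<tau>\<close> into \<open>0 \<le> \<sigma>\<close>, \<open>\<tau> \<le> \<beta>\<close> and \<open>\<sigma> \<le> \<alpha>\<close>. So \<open>w\<close> and \<open>z - w\<close> lie in the cone over
  \<open>a\<close> and \<open>b\<close>, and \<open>z\<close> does not decompose.\<close>

lemma thin_comb:
  fixes \<alpha> \<beta> :: real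
  assumes z: "graver A z"
    and span: "\<And>w. w \<in> int_kernel A \<Longrightarrow> \<exists>(\<sigma> :: real) (\<tau> :: real). \<forall>i. real_of_int (w $ i) = \<sigma> * a $ i + \<tau> * b $ i"
    and ker: "a \<in> int_kernel A" "b \<in> int_kernel A"
    and sc: "sign_compatible z a" "sign_compatible z b"
    and thin: "thin A a" "thin A b"
    and m: "minor k l a b \<noteq> 0" and nonneg: "0 \<le> \<alpha>" "0 \<le> \<beta>"
    and zi: "\<And>i. real_of_int (z $ i) = \<alpha> * a $ i + \<beta> * b $ i"
  shows "thin A z"
  unfolding thin_def
proof (intro ballI impI)
  fix w assume w: "w \<in> int_kernel A" "\<forall>i. w $ i \<le> max 0 (z $ i)"
  have zker: "z \<in> int_kernel A" using z by (simp add: graver_def)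
  have le1: "\<alpha> + \<beta> \<le> 1"
    by (rule graver_comb_le_1[OF z ker sc m nonneg]) (rule zi)
  obtain \<sigma> :: real and \<tau> :: real where wi: "\<And>i. real_of_int (w $ i) = \<sigma> * a $ i + \<tau> * b $ i"
    using span[OF w(1)] by blast
  have m': "minor k l b a \<noteq> 0" using m by (simp add: minor_def algebra_simps)
  have mm: "minor k l (- a) (- b) \<noteq> 0" "minor k l (- b) (- a) \<noteq> 0" using m m' by (simp_all add: minor_def)
  have wi': "real_of_int ((w - z) $ i) = (\<alpha> - \<sigma>) * (- a) $ i + (\<beta> - \<tau>) * (- b) $ i" for i
    by (simp add: wi zi algebra_simps)
  have w': "(w - z) $ i \<le> max 0 ((- z) $ i)" for i
    using w(2)[rule_format, of i] by (simp add: max_def split: if_splits)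
  note nker = ker[THEN int_kernel_uminus] and nsc = sc[THEN sign_compatible_uminus]
    and nthin = thin_uminus[OF thin(1) ker(1)] thin_uminus[OF thin(2) ker(2)]
    and wz = int_kernel_diff[OF w(1) zker]
  have "0 \<le> \<tau>"
    by (rule thin_comb_aux[OF ker w(1) sc thin m nonneg le1]) (use zi w(2) wi in auto)
  moreover have "0 \<le> \<sigma>"
    by (rule thin_comb_aux[OF ker(2,1) w(1) sc(2,1) thin(2,1) m' nonneg(2,1)])
      (use le1 zi w(2) wi in \<open>auto simp: add.commute\<close>)
  moreover have "0 \<le> \<beta> - \<tau>"
    by (rule thin_comb_aux[OF nker wz nsc nthin mm(1) nonneg le1])
      (use zi w' wi' in auto)
  moreover have "0 \<le> \<alpha> - \<sigma>"
    by (rule thin_comb_aux[OF nker(2,1) wz nsc(2,1) nthin(2,1) mm(2) nonneg(2,1)])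
      (use le1 zi w' wi' in \<open>auto simp: add.commute\<close>)
  ultimately have "sign_compatible z w" "sign_compatible z (z - w)"
    by (auto intro!: sign_compatible_comb[OF sc _ _ wi]
        sign_compatible_comb[OF sc, of "\<alpha> - \<sigma>" "\<beta> - \<tau>"] simp: wi zi algebra_simps)
  then show "w = 0 \<or> w = z" using graverD[OF z w(1)] by blast
qed

text \<open>The rows of \<open>A\<close> span a space of dimension \<open>n - 2\<close>, and the kernel is its orthogonal
  complement; so two kernel vectors with a nonzero minor form a basis of it.\<close>

lemma rank_two_kernel_span:
  fixes A :: "int ^ 'n::finite ^ 'm::finite"
  assumes rank: "rank (map_matrix real_of_int A) + 2 = CARD('n)"
    and ker: "a \<in> int_kernel A" "b \<in> int_kernel A" "w \<in> int_kernel A"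
    and m: "minor k l a b \<noteq> 0"
  shows "\<exists>(\<sigma> :: real) (\<tau> :: real). \<forall>i. real_of_int (w $ i) = \<sigma> * a $ i + \<tau> * b $ i"
proof -
  define R where "R = map_matrix real_of_int A"
  define r :: "int ^ 'n \<Rightarrow> real ^ 'n" where "r = (\<lambda>v. \<chi> i. real_of_int (v $ i))"
  let ?K = "{y \<in> UNIV. \<forall>x\<in>span (rows R). orthogonal x y}"
  have "dim ?K + dim (span (rows R)) = dim (UNIV :: (real ^ 'n) set)"
    by (rule dim_subspace_orthogonal_to_vectors) auto
  then have dimK: "dim ?K = 2" using rank by (simp add: R_def row_rank_def)
  have inK: "r v \<in> ?K" if "v \<in> int_kernel A" for v
  proof -
    have "orthogonal (row j R) (r v)" for j
    proof -
      have "row j R \<bullet> r v = (\<Sum>i\<in>UNIV. real_of_int (A $ j $ i * v $ i))"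
        by (simp add: inner_vec_def row_def r_def R_def)
      also have "\<dots> = real_of_int ((A *v v) $ j)" by (simp add: matrix_vector_mult_def)
      also have "\<dots> = 0" using that by (simp add: int_kernel_def)
      finally show ?thesis by (simp add: orthogonal_def)
    qed
    then have "\<And>y. y \<in> rows R \<Longrightarrow> orthogonal (r v) y"
      unfolding rows_def orthogonal_commute[of "r v"] by blast
    then have "orthogonal (r v) x" if "x \<in> span (rows R)" for x
      using orthogonal_to_span[OF that] by blast
    then show ?thesis by (simp add: orthogonal_commute)
  qed
  have no_mult: "\<beta> = 0 \<and> \<alpha> = 0" if "\<alpha> *\<^sub>R r a + \<beta> *\<^sub>R r b = 0" for \<alpha> \<beta> :: real
  proof -
    have eq: "\<alpha> * a $ i + \<beta> * b $ i = 0" for i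
      using that by (simp add: vec_eq_iff r_def)
    have "\<alpha> * minor k l a b = (\<alpha> * a $ k + \<beta> * b $ k) * b $ l - (\<alpha> * a $ l + \<beta> * b $ l) * b $ k"
      "\<beta> * minor k l a b = (\<alpha> * a $ l + \<beta> * b $ l) * a $ k - (\<alpha> * a $ k + \<beta> * b $ k) * a $ l"
      by (simp_all add: minor_def algebra_simps)
    then have "\<alpha> * minor k l a b = 0" "\<beta> * minor k l a b = 0" by (simp_all only: eq)
    then show ?thesis using m by simp
  qed
  have "r a \<noteq> r b" using no_mult[of 1 "-1"] by auto
  moreover have "r b \<noteq> 0" using no_mult[of 0 1] by auto
  moreover have "r a \<notin> span {r b}"
  proof
    assume "r a \<in> span {r b}"
    then obtain c where "r a = c *\<^sub>R r b" by (auto simp: span_singleton)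
    with no_mult[of 1 "- c"] show False by simp
  qed
  ultimately have indep: "independent {r a, r b}" and card: "card {r a, r b} = 2"
    by (simp_all add: independent_insert)
  have "?K \<subseteq> span {r a, r b}"
  proof (rule card_ge_dim_independent)
    show "{r a, r b} \<subseteq> ?K" using inK[OF ker(1)] inK[OF ker(2)] by blast
    show "independent {r a, r b}" by (rule indep)
    show "dim ?K \<le> card {r a, r b}" unfolding card dimK by (rule order_refl)
  qed
  then have "r w \<in> span {r a, r b}" using inK[OF ker(3)] by blast
  then obtain \<sigma> :: real where "r w - \<sigma> *\<^sub>R r a \<in> span {r b}" 
    unfolding span_breakdown_eq by blast
  then obtain \<tau> :: real where "r w - \<sigma> *\<^sub>R r a = \<tau> *\<^sub>R r b" by (auto simp: span_singleton)
  then have "r w = \<sigma> *\<^sub>R r a + \<tau> *\<^sub>R r b" by (simp add: algebra_simps)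
  then show ?thesis by (auto simp: vec_eq_iff r_def)
qed

text \<open>Subtracting the largest multiple of \<open>v\<close> that keeps the signs of \<open>z\<close> makes a coordinate
  vanish.\<close>

lemma sign_compatible_reduction:
  fixes z v :: "int ^ 'n::finite"
  assumes "0 < v $ i * z $ i" and supp: "\<And>j. z $ j = 0 \<Longrightarrow> v $ j = 0"
  obtains p q k where "0 < p" "0 < q" "sign_compatible z (p *s z - q *s v)"
    "(p *s z - q *s v) $ k = 0" "z $ k \<noteq> 0" "v $ k \<noteq> 0"
proof -
  let ?S = "{k. 0 < v $ k * z $ k}"
  let ?t = "\<lambda>k. \<bar>real_of_int (z $ k)\<bar> / \<bar>real_of_int (v $ k)\<bar>"
  have "finite ?S" "?S \<noteq> {}" using assms by auto
  then obtain k where k: "k \<in> ?S" "\<And>j. j \<in> ?S \<Longrightarrow> ?t k \<le> ?t j"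
    using that arg_min_if_finite(1)[of ?S ?t] arg_min_least[of ?S _ ?t] by blast
  have nz: "v $ k \<noteq> 0" "z $ k \<noteq> 0" using k(1) by (metis mem_Collect_eq less_irrefl mult_zero_left mult_zero_right)+
  have le: "\<bar>z $ k\<bar> * \<bar>v $ j\<bar> \<le> \<bar>v $ k\<bar> * \<bar>z $ j\<bar>" if "j \<in> ?S" for j
  proof -
    have "v $ j \<noteq> 0" using that by auto
    then have "\<bar>real_of_int (z $ k)\<bar> * \<bar>real_of_int (v $ j)\<bar> \<le> \<bar>real_of_int (v $ k)\<bar> * \<bar>real_of_int (z $ j)\<bar>"
      using k(2)[OF that] nz by (simp add: field_simps)
    then have "real_of_int (\<bar>z $ k\<bar> * \<bar>v $ j\<bar>) \<le> real_of_int (\<bar>v $ k\<bar> * \<bar>z $ j\<bar>)" by simp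
    then show ?thesis by (simp only: of_int_le_iff)
  qed
  show ?thesis
  proof
    show "0 < \<bar>v $ k\<bar>" "0 < \<bar>z $ k\<bar>" "z $ k \<noteq> 0" "v $ k \<noteq> 0" using nz by auto
    show "(\<bar>v $ k\<bar> *s z - \<bar>z $ k\<bar> *s v) $ k = 0"
      using k(1) by (auto simp: abs_if zero_less_mult_iff)
    show "sign_compatible z (\<bar>v $ k\<bar> *s z - \<bar>z $ k\<bar> *s v)"
      unfolding sign_compatible_def
    proof (intro allI conjI impI)
      fix j
      show "0 \<le> (\<bar>v $ k\<bar> *s z - \<bar>z $ k\<bar> *s v) $ j" if z: "0 \<le> z $ j"
      proof (cases "j \<in> ?S")
        case True
        with z have "0 < v $ j" by (auto simp: zero_less_mult_iff)
        with le[OF True] z show ?thesis by simp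
      next
        case False
        with z supp[of j] have "v $ j \<le> 0" by (cases "z $ j = 0") (auto simp: zero_less_mult_iff not_less)
        with z have "\<bar>z $ k\<bar> * v $ j \<le> 0" "0 \<le> \<bar>v $ k\<bar> * z $ j"
          by (auto intro: mult_nonneg_nonpos)
        then show ?thesis by simp
      qed
      show "(\<bar>v $ k\<bar> *s z - \<bar>z $ k\<bar> *s v) $ j \<le> 0" if z: "z $ j \<le> 0"
      proof (cases "j \<in> ?S")
        case True
        with z have "v $ j < 0" by (auto simp: zero_less_mult_iff)
        with le[OF True] z show ?thesis by simp
      next
        case False
        with z supp[of j] have "0 \<le> v $ j" by (cases "z $ j = 0") (auto simp: zero_less_mult_iff not_less)
        with z have "0 \<le> \<bar>z $ k\<bar> * v $ j" "\<bar>v $ k\<bar> * z $ j \<le> 0"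
          by (auto intro: mult_nonneg_nonpos)
        then show ?thesis by simp
      qed
    qed
  qed
qed

section \<open>Circuits\<close>

definition support :: "int ^ 'n \<Rightarrow> 'n set" where
  "support u = {i. u $ i \<noteq> 0}"

definition circuit_vec :: "int ^ 'n::finite ^ 'm \<Rightarrow> int ^ 'n \<Rightarrow> bool" where
  "circuit_vec A u \<longleftrightarrow> u \<in> int_kernel A \<and> primitive_vec u \<and>
     (\<forall>v\<in>int_kernel A. v \<noteq> 0 \<longrightarrow> \<not> support v \<subset> support u)"

lemma primitive_vec_neq_0: "primitive_vec u \<Longrightarrow> u \<noteq> 0"
  by (auto simp: primitive_vec_def)

lemma circuit_vecD:
  assumes "circuit_vec A u"
  shows "u \<in> int_kernel A" "primitive_vec u" "u \<noteq> 0"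
    "v \<in> int_kernel A \<Longrightarrow> support v \<subset> support u \<Longrightarrow> v = 0"
  using assms by (auto simp: circuit_vec_def primitive_vec_neq_0)

lemma vars_kernel_binomial:
  assumes "u \<noteq> 0"
  shows "vars (kernel_binomial u :: ('n::finite, 'k::comm_ring_1) mpoly) = support u"
  using keys_kernel_binomial[OF assms, where ?'k = 'k]
  by (auto simp: vars_def support_def in_keys_iff)

lemma int_kernel_scale: "u \<in> int_kernel A \<Longrightarrow> c *s u \<in> int_kernel A"
  using int_kernel_scale_iff[of c u A] by (cases "c = 0") (auto simp: int_kernel_def)

text \<open>The linear form with value \<open>1\<close> at \<open>u\<close> reads off the coefficient and shows that it is an integer.\<close>

lemma primitive_vec_parallel:
  assumes "primitive_vec u" "u $ l \<noteq> 0" "u $ l *s x = c *s u"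
  obtains k where "x = k *s u"
proof -
  obtain \<omega> where \<omega>: "(\<Sum>i\<in>UNIV. \<omega> i * u $ i) = 1" using assms(1) by (auto simp: primitive_vec_def)
  have eq: "u $ l * x $ i = c * u $ i" for i
    using arg_cong[OF assms(3), of "\<lambda>y. y $ i"] by simp
  have "u $ l * (\<Sum>i\<in>UNIV. \<omega> i * x $ i) = (\<Sum>i\<in>UNIV. \<omega> i * (u $ l * x $ i))"
    by (simp add: sum_distrib_left mult.left_commute)
  also have "\<dots> = c * (\<Sum>i\<in>UNIV. \<omega> i * u $ i)"
    by (simp add: eq sum_distrib_left mult.left_commute)
  finally have c: "c = u $ l * (\<Sum>i\<in>UNIV. \<omega> i * x $ i)" by (simp add: \<omega>)
  define k where "k = (\<Sum>i\<in>UNIV. \<omega> i * x $ i)"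
  have "x $ i = k * u $ i" for i
  proof -
    have "u $ l * x $ i = u $ l * (k * u $ i)" by (simp add: eq c k_def)
    then show ?thesis using assms(2) by simp
  qed
  then have "x = k *s u" by (simp add: vec_eq_iff)
  then show ?thesis by (rule that)
qed

text \<open>A suitable combination of \<open>x\<close> and \<open>u\<close> kills a coordinate, hence vanishes by minimality of the
  support.\<close>

lemma circuit_vec_parallel:
  assumes u: "circuit_vec A u" and x: "x \<in> int_kernel A" "support x \<subseteq> support u"
  obtains k where "x = k *s u"
proof -
  obtain l where l: "u $ l \<noteq> 0" using circuit_vecD(3)[OF u] by (auto simp: vec_eq_iff)
  let ?y = "u $ l *s x - x $ l *s u"
  have "?y \<in> int_kernel A" using circuit_vecD(1)[OF u] x by (intro int_kernel_diff int_kernel_scale)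
  moreover have "support ?y \<subset> support u"
  proof
    show "support ?y \<subseteq> support u" using x(2) by (auto simp: support_def)
    have "l \<in> support u" "l \<notin> support ?y" using l by (auto simp: support_def)
    then show "support ?y \<noteq> support u" by blast
  qed
  ultimately have "?y = 0" by (rule circuit_vecD(4)[OF u])
  then have "u $ l *s x = x $ l *s u" by simp
  then show ?thesis by (rule primitive_vec_parallel[OF circuit_vecD(2)[OF u] l _ that])
qed

lemma graver_primitive:
  assumes "graver A z"
  shows "primitive_vec z"
proof -
  have "z \<noteq> 0" "z \<in> int_kernel A" using assms by (auto simp: graver_def)
  obtain d v where d: "0 < d" "z = d *s v" "primitive_vec v"
    by (rule primitive_vec_multiple[OF \<open>z \<noteq> 0\<close>])
  have "v \<in> int_kernel A" using d \<open>z \<in> int_kernel A\<close> int_kernel_scale_iff[of d v A] by simp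
  moreover have "sign_compatible z v" "sign_compatible z (z - v)"
    using d(1) mult_right_mono[of 1 d] mult_right_mono_neg[of 1 d]
    by (auto simp: sign_compatible_def d(2) zero_le_mult_iff mult_le_0_iff)
  ultimately have "v = 0 \<or> v = z" using graverD[OF assms] by blast
  then show ?thesis using d \<open>z \<noteq> 0\<close> by auto
qed

lemma pos_part_split:
  assumes "sign_compatible z w" "sign_compatible z (z - w)"
  shows "pos_part z = pos_part w + pos_part (z - w)"
proof (rule poly_mapping_eqI)
  fix i
  show "Poly_Mapping.lookup (pos_part z) i = Poly_Mapping.lookup (pos_part w + pos_part (z - w)) i"
    using assms[unfolded sign_compatible_def, rule_format, of i]
    by (cases "0 \<le> z $ i") (auto simp: lookup_add simp flip: nat_add_distrib)
qed

context pointed_kernel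
begin

lemma
  assumes "u \<in> int_kernel A" "u \<noteq> 0"
  shows kernel_pos_coordinate: "\<exists>i. 0 < u $ i" and kernel_neg_coordinate: "\<exists>i. u $ i < 0"
  using nonneg_kernel_eq_0[of u] nonneg_kernel_eq_0[of "- u"] int_kernel_uminus assms
  by (auto simp: not_less[symmetric])

text \<open>Over a pointed kernel neither monomial of a binomial is constant, so irreducibility amounts to
  primitivity.\<close>

lemma circuits_eq:
  "circuits A = (kernel_binomial ` {u. circuit_vec A u} :: ('n, 'k::field) mpoly set)"
proof -
  have "u \<in> int_kernel A \<and> u \<noteq> 0 \<and> irreducible (kernel_binomial u :: ('n, 'k) mpoly) \<and>
      (\<forall>v\<in>int_kernel A. v \<noteq> 0 \<longrightarrow>
        \<not> vars (kernel_binomial v :: ('n, 'k) mpoly) \<subset> vars (kernel_binomial u :: ('n, 'k) mpoly))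
    \<longleftrightarrow> circuit_vec A u" for u
  proof (cases "u \<in> int_kernel A \<and> u \<noteq> 0")
    case True
    then have nc: "pos_part u \<noteq> 0" "pos_part (- u) \<noteq> 0"
      using kernel_pos_coordinate[of u] kernel_neg_coordinate[of u]
      by (auto simp: pos_part_eq_0_iff not_le)
    with True show ?thesis
      using irreducible_kernel_binomial[OF _ nc, where ?'k = 'k] primitive_vec_if_irreducible[OF _ nc, where ?'k = 'k]
      by (auto simp: circuit_vec_def vars_kernel_binomial)
  qed (auto simp: circuit_vec_def dest: primitive_vec_neq_0)
  then show ?thesis by (auto simp: circuits_def)
qed

text \<open>The disjoint supports of \<open>u\<^sup>+\<close> and \<open>u\<^sup>-\<close> force \<open>0 \<le> k \<le> 1\<close>.\<close>

lemma fibre_on_line: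
  assumes u: "u \<in> int_kernel A" "u \<noteq> 0" and s: "expo_vec s = expo_vec (pos_part (- u)) + k *s u"
  shows "s = pos_part u \<or> s = pos_part (- u)"
proof -
  have sk: "int (Poly_Mapping.lookup s i) = int (nat (- u $ i)) + k * u $ i" for i
    using arg_cong[OF s, of "\<lambda>v. v $ i"] by simp
  obtain i j where "0 < u $ i" "u $ j < 0" using kernel_pos_coordinate[OF u] kernel_neg_coordinate[OF u] by blast
  have "0 \<le> k * u $ i" using sk[of i] \<open>0 < u $ i\<close> by simp
  then have "0 \<le> k" using \<open>0 < u $ i\<close> by (simp add: zero_le_mult_iff)
  have "(k - 1) * u $ j = int (Poly_Mapping.lookup s j)"
    using sk[of j] \<open>u $ j < 0\<close> by (simp add: left_diff_distrib)
  then have "0 \<le> (k - 1) * u $ j" by linarith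
  then have "k \<le> 1" using \<open>u $ j < 0\<close> unfolding zero_le_mult_iff by linarith
  with \<open>0 \<le> k\<close> have "k = 0 \<or> k = 1" by linarith
  then have "expo_vec s = expo_vec (pos_part (- u)) \<or> expo_vec s = expo_vec (pos_part u)"
    using s expo_vec_pos_part_diff[of u] by (auto simp: algebra_simps)
  then show ?thesis by auto
qed

end


text \<open>Reduce \<open>z\<close> along a kernel vector of smaller support to reach a circuit \<open>a\<close> in the same orthant, and
  then reduce \<open>z\<close> along \<open>a\<close>. In a plane, any primitive vector with a zero coordinate where \<open>z\<close> is
  nonzero is a circuit.\<close>

lemma graver_circuit_comb:
  fixes A :: "int ^ 'n::finite ^ 'm::finite"
  assumes rank: "rank (map_matrix real_of_int A) + 2 = CARD('n)"
    and z: "graver A z" and nc: "\<not> circuit_vec A z"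
  obtains a b k l and \<alpha> \<beta> :: real where "circuit_vec A a" "circuit_vec A b"
    "sign_compatible z a" "sign_compatible z b" "minor k l a b \<noteq> 0" "0 \<le> \<alpha>" "0 \<le> \<beta>"
    "\<And>i. real_of_int (z $ i) = \<alpha> * a $ i + \<beta> * b $ i"
proof -
  have zk: "z \<in> int_kernel A" using z by (simp add: graver_def)
  have circ: "circuit_vec A c"
    if c: "c \<in> int_kernel A" "primitive_vec c" "c $ k = 0" and k: "z $ k \<noteq> 0" for c k
  proof -
    have "v = 0" if v: "v \<in> int_kernel A" "support v \<subset> support c" for v
    proof (rule ccontr)
      assume "v \<noteq> 0"
      obtain l where l: "c $ l \<noteq> 0" using primitive_vec_neq_0[OF c(2)] by (auto simp: vec_eq_iff)
      have "minor k l c z \<noteq> 0" using l k c(3) by (simp add: minor_def)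
      then obtain \<sigma> :: real and \<tau> :: real where v_eq: "\<And>i. real_of_int (v $ i) = \<sigma> * c $ i + \<tau> * z $ i"
        using rank_two_kernel_span[OF rank c(1) zk v(1)] by blast
      have "v $ k = 0" using v(2) c(3) by (auto simp: support_def)
      with v_eq[of k] c(3) k have "\<tau> = 0" by simp
      with v_eq \<open>v \<noteq> 0\<close> have "\<sigma> \<noteq> 0" by (auto simp: vec_eq_iff)
      with v_eq \<open>\<tau> = 0\<close> have "v $ i = 0 \<longleftrightarrow> c $ i = 0" for i
        by (metis add.right_neutral mult_eq_0_iff mult_zero_left of_int_eq_0_iff)
      with v(2) show False by (auto simp: support_def)
    qed
    with c show ?thesis by (auto simp: circuit_vec_def)
  qed
  (* c spans the ray where the half-line from z in direction -v leaves the cone of the vectors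
     that are sign-compatible with z *)
  have reduce: "\<exists>p d c k. 0 < p \<and> 0 < d \<and> c \<in> int_kernel A \<and> primitive_vec c \<and> sign_compatible z c \<and>
      c $ k = 0 \<and> z $ k \<noteq> 0 \<and> v $ k \<noteq> 0 \<and> (\<exists>q>0. p *s z - q *s v = d *s c)"
    if v: "v \<in> int_kernel A" "0 < v $ i * z $ i" "support v \<subseteq> support z"
      and j: "z $ j \<noteq> 0" "v $ j = 0" for v i j
  proof -
    have "v $ k = 0" if "z $ k = 0" for k using v(3) that by (auto simp: support_def)
    from sign_compatible_reduction[OF v(2) this]
    obtain p q k where r: "0 < p" "0 < q" "sign_compatible z (p *s z - q *s v)"
      "(p *s z - q *s v) $ k = 0" "z $ k \<noteq> 0" "v $ k \<noteq> 0" by metis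
    have "(p *s z - q *s v) $ j \<noteq> 0" using r(1) j by simp
    then have "p *s z - q *s v \<noteq> 0" by (metis zero_index)
    then obtain d c where d: "0 < d" "p *s z - q *s v = d *s c" "primitive_vec c"
      by (rule primitive_vec_multiple)
    have "d *s c \<in> int_kernel A"
      unfolding d(2)[symmetric] using zk v(1) by (intro int_kernel_diff int_kernel_scale)
    then have "c \<in> int_kernel A" using d(1) int_kernel_scale_iff[of d c A] by simp
    moreover have "c $ k = 0" using r(4) d(1) unfolding d(2) by simp
    moreover have "sign_compatible z c"
      using r(3) d(1) unfolding d(2) by (auto simp: sign_compatible_def zero_le_mult_iff mult_le_0_iff)
    ultimately show ?thesis using r d by blast
  qed
  obtain v where v: "v \<in> int_kernel A" "v \<noteq> 0" "support v \<subset> support z"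
    using nc graver_primitive[OF z] zk by (auto simp: circuit_vec_def)
  then obtain i j where ij: "v $ i \<noteq> 0" "z $ i \<noteq> 0" "z $ j \<noteq> 0" "v $ j = 0"
    by (auto simp: support_def vec_eq_iff)
  obtain v' where v': "v' \<in> int_kernel A" "0 < v' $ i * z $ i" "support v' \<subseteq> support z" "v' $ j = 0"
  proof (cases "0 < v $ i * z $ i")
    case False
    then have "0 < (- v) $ i * z $ i" using ij by (simp add: not_less order_less_le)
    moreover have "support (- v) = support v" by (simp add: support_def)
    ultimately show ?thesis using that[of "- v"] v(3) int_kernel_uminus[OF v(1)] ij(4) by auto
  qed (use that[of v] v ij in auto)
  obtain a k where a: "a \<in> int_kernel A" "primitive_vec a" "sign_compatible z a" "a $ k = 0" "z $ k \<noteq> 0"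
    using reduce[OF v'(1-3) ij(3) v'(4)] by blast
  obtain m where "a $ m \<noteq> 0" using primitive_vec_neq_0[OF a(2)] by (auto simp: vec_eq_iff)
  then have "0 < a $ m * z $ m"
    using a(3)[unfolded sign_compatible_def, rule_format, of m] sign_compatible_zero[OF a(3), of m]
    unfolding zero_less_mult_iff by linarith
  moreover have "support a \<subseteq> support z"
    using sign_compatible_zero[OF a(3)] by (auto simp: support_def)
  ultimately obtain p d b l q where b: "0 < p" "0 < d" "b \<in> int_kernel A" "primitive_vec b"
    "sign_compatible z b" "b $ l = 0" "z $ l \<noteq> 0" "a $ l \<noteq> 0" "0 < q" "p *s z - q *s a = d *s b"
    using reduce[OF a(1) _ _ a(5,4)] by blast
  have bi: "p * z $ i - q * a $ i = d * b $ i" for i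
    using arg_cong[OF b(10), of "\<lambda>x. x $ i"] by simp
  show ?thesis
  proof (rule that)
    show "circuit_vec A a" "circuit_vec A b" using circ a b by blast+
    have "b $ k \<noteq> 0" using bi[of k] a(4,5) b(1) by auto
    then show "minor k l a b \<noteq> 0" using a(4) b(6,8) by (simp add: minor_def)
    show "real_of_int (z $ i) = (q / p) * a $ i + (d / p) * b $ i" for i
    proof -
      have "p * z $ i = q * a $ i + d * b $ i" using bi[of i] by linarith
      then have "real_of_int (p * z $ i) = real_of_int (q * a $ i + d * b $ i)" by (simp only:)
      then show ?thesis using b(1) by (simp add: field_simps)
    qed
  qed (use a b in auto)
qed

section \<open>The universal Groebner basis\<close>

context pointed_kernel_order
begin

text \<open>If \<open>z = w + (z - w)\<close> were a decomposition without cancellation, the smaller binomials of \<open>w\<close> and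
  \<open>z - w\<close> would either make a proper divisor of \<open>a\<close> nonstandard or, both being led by their negative
  parts, contradict that \<open>a\<close> leads the binomial of \<open>z\<close>.\<close>

lemma graver_leads:
  assumes a: "a \<in> leads"
  shows "graver A (expo_vec a - expo_vec (normal_form a))"
proof -
  define z where "z = expo_vec a - expo_vec (normal_form a)"
  have z: "a = pos_part z" "normal_form a = pos_part (- z)" "z \<in> int_kernel A" "z \<noteq> 0"
    using leads_pos_part[OF a] by (simp_all add: z_def)
  have not_le: "x = z" if x: "x \<in> int_kernel A" "x \<noteq> 0" "sign_compatible z x" "sign_compatible z (z - x)"
    and le: "le (pos_part (- x)) (pos_part x)" for x
  proof -
    have "\<not> standard (pos_part x)"
      using x le nonstandard_iff adeg_pos_part pos_part_neq by metis
    moreover have split: "pos_part z = pos_part x + pos_part (z - x)"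
      by (rule pos_part_split) fact+
    then have "divides (pos_part x) a" by (auto simp: z(1) divides_def)
    ultimately have "pos_part x = a" using a by (auto simp: leads_def)
    with split have "pos_part (z - x) = 0" by (simp add: z(1))
    then have "\<forall>i. (z - x) $ i \<le> 0" unfolding pos_part_eq_0_iff .
    then have "0 \<le> (- (z - x)) $ i" for i by simp
    then have "- (z - x) = 0"
      using int_kernel_uminus[OF int_kernel_diff[OF z(3) x(1)]] nonneg_kernel_eq_0 by blast
    then show ?thesis by simp
  qed
  have "w = 0 \<or> w = z"
    if w: "w \<in> int_kernel A" "sign_compatible z w" "sign_compatible z (z - w)" for w
  proof (rule ccontr)
    assume "\<not> ?thesis"
    then have ne: "w \<noteq> 0" "w \<noteq> z" "z - w \<noteq> 0" "z - w \<noteq> z" by auto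
    have "\<not> le (pos_part (- w)) (pos_part w)" using not_le[of w] w ne by blast
    moreover have "\<not> le (pos_part (- (z - w))) (pos_part (z - w))"
      using not_le[of "z - w"] w ne int_kernel_diff[OF z(3) w(1)] by auto
    ultimately have "le (pos_part w + pos_part (z - w)) (pos_part (- w) + pos_part (- (z - w)))"
      using le_total by (intro add_mono) blast+
    moreover have "pos_part w + pos_part (z - w) = a"
      "pos_part (- w) + pos_part (- (z - w)) = normal_form a"
      using pos_part_split[OF w(2,3)] pos_part_split[of "- z" "- w"] w(2,3)[THEN sign_compatible_uminus]
      unfolding z(2) by (simp_all add: z(1))
    ultimately have "le a (normal_form a)" by simp
    then show False using normal_form_le[of a] leads_normal_form_neq[OF a] le_antisym by blast
  qed
  with z show ?thesis unfolding z_def[symmetric] by (auto simp: graver_def)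
qed

end

context pointed_kernel
begin

lemma gb_in_universal_groebner_basis:
  assumes "monomial_order le" "g \<in> pointed_kernel_order.gb A le"
  shows "{g, - g} \<in> universal_groebner_basis (toric_ideal A :: ('n, 'k::field) mpoly set)"
proof -
  interpret pointed_kernel_order A le by unfold_locales fact
  show ?thesis
    using assms reduced_groebner_basis_gb unfolding universal_groebner_basis_def by blast
qed

lemma universal_groebner_basis_graver:
  assumes "C \<in> universal_groebner_basis (toric_ideal A :: ('n, 'k::field) mpoly set)"
  obtains u where "graver A u" "C = {kernel_binomial u, - kernel_binomial u}"
proof -
  obtain le G g where g: "monomial_order le" "reduced_groebner_basis le (toric_ideal A) G" "g \<in> G" "C = {g, - g}"
    using assms by (auto simp: universal_groebner_basis_def)
  interpret pointed_kernel_order A le by unfold_locales fact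
  obtain a where a: "a \<in> leads" "g = monom a - monom (normal_form a)"
    using reduced_groebner_basis_subset_gb[OF g(2)] g(3) by (auto simp: gb_def)
  show ?thesis
  proof (rule that)
    show "graver A (expo_vec a - expo_vec (normal_form a))" using a(1) by (rule graver_leads)
    show "C = {kernel_binomial (expo_vec a - expo_vec (normal_form a)),
        - kernel_binomial (expo_vec a - expo_vec (normal_form a))}"
      unfolding g(4) a(2) kernel_binomial_def leads_pos_part(1,2)[OF a(1), symmetric] by (rule refl)
  qed
qed

lemma Union_universal_groebner_basis_subset:
  "\<Union> (universal_groebner_basis (toric_ideal A :: ('n, 'k::field) mpoly set)) \<subseteq> toric_ideal A"
proof clarify
  fix f C assume "f \<in> C" "C \<in> universal_groebner_basis (toric_ideal A :: ('n, 'k) mpoly set)"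
  then obtain u where "graver A u" "f = kernel_binomial u \<or> f = kernel_binomial (- u)"
    by (metis universal_groebner_basis_graver insertE kernel_binomial_uminus singletonD)
  then show "f \<in> toric_ideal A"
    by (auto simp: graver_def intro!: kernel_binomial_in_toric_ideal int_kernel_uminus)
qed

text \<open>For an order that eliminates the variables outside the support of the circuit, every
  reduction of a divisor of \<open>x\<^bsup>u+\<^esup>\<close> stays inside the support, where the kernel is \<open>\<int>u\<close>.\<close>

lemma circuit_in_universal_groebner_basis:
  assumes u: "circuit_vec A u"
  shows "{kernel_binomial u, - kernel_binomial u}
    \<in> universal_groebner_basis (toric_ideal A :: ('n, 'k::field) mpoly set)"
proof -
  define \<omega> :: "'n \<Rightarrow> int" where "\<omega> = (\<lambda>i. if u $ i = 0 then 1 else 0)"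
  interpret pointed_kernel_order A "weight_le \<omega>"
    by unfold_locales (simp add: monomial_order_weight_le \<omega>_def)
  have weight_0: "weight \<omega> s \<le> 0 \<longleftrightarrow> (\<forall>i. u $ i = 0 \<longrightarrow> Poly_Mapping.lookup s i = 0)" for s
  proof -
    have "weight \<omega> s \<le> 0 \<longleftrightarrow> weight \<omega> s = 0"
      using sum_nonneg[of UNIV "\<lambda>i. \<omega> i * int (Poly_Mapping.lookup s i)"]
      by (auto simp: weight_def \<omega>_def)
    also have "\<dots> \<longleftrightarrow> (\<forall>i. \<omega> i * int (Poly_Mapping.lookup s i) = 0)"
      unfolding weight_def by (subst sum_nonneg_eq_0_iff) (auto simp: \<omega>_def)
    finally show ?thesis by (auto simp: \<omega>_def)
  qed
  have line: "\<exists>k. expo_vec b - expo_vec (normal_form b) = k *s u" if b: "weight \<omega> b \<le> 0" for b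
  proof -
    have "weight \<omega> (normal_form b) \<le> 0"
      using normal_form_le[of b] b by (auto simp: weight_le_def)
    then have "support (expo_vec b - expo_vec (normal_form b)) \<subseteq> support u"
      using b by (auto simp: support_def weight_0)
    moreover have "expo_vec b - expo_vec (normal_form b) \<in> int_kernel A"
      by (simp add: adeg_normal_form flip: adeg_eq_iff)
    ultimately show ?thesis using circuit_vec_parallel[OF u] by metis
  qed
  have main: "kernel_binomial v \<in> (gb :: ('n, 'k) mpoly set)"
    if v: "v = u \<or> v = - u" and le: "weight_le \<omega> (pos_part (- v)) (pos_part v)" for v
  proof -
    have vker: "v \<in> int_kernel A" "v \<noteq> 0"
      using v circuit_vecD[OF u] int_kernel_uminus by auto
    have line_v: "\<exists>k. expo_vec b - expo_vec (normal_form b) = k *s v" if b: "weight \<omega> b \<le> 0" for b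
    proof -
      obtain k where "expo_vec b - expo_vec (normal_form b) = k *s u" using line[OF b] by blast
      also have "k *s u = (if v = u then k else - k) *s v" using v by (auto simp: vec_eq_iff)
      finally show ?thesis by blast
    qed
    have w0: "weight \<omega> (pos_part v) \<le> 0" using v by (auto simp: weight_0)
    have nonstd: "\<not> standard (pos_part v)"
      using le vker nonstandard_iff adeg_pos_part pos_part_neq by metis
    obtain k where "expo_vec (pos_part v) - expo_vec (normal_form (pos_part v)) = k *s v"
      using line_v[OF w0] by blast
    then have "expo_vec (normal_form (pos_part v)) = expo_vec (pos_part (- v)) + (1 - k) *s v"
      using expo_vec_pos_part_diff[of v] by (simp add: vec_eq_iff algebra_simps)
    then have nf: "normal_form (pos_part v) = pos_part (- v)"
      using fibre_on_line[OF vker] normal_form_neq[OF nonstd] by blast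
    have "b = pos_part v" if b: "divides b (pos_part v)" "\<not> standard b" for b
    proof -
      have "weight \<omega> b \<le> 0"
        using w0 b(1) unfolding weight_0 divides_iff by (metis le_zero_eq)
      then obtain k where k: "expo_vec b - expo_vec (normal_form b) = k *s v" using line_v by blast
      have ki: "int (Poly_Mapping.lookup (normal_form b) i) = int (Poly_Mapping.lookup b i) - k * v $ i" for i
        using arg_cong[OF k, of "\<lambda>x. x $ i"] by simp
      have b_le: "Poly_Mapping.lookup b i \<le> nat (v $ i)" for i
        using b(1) by (simp add: divides_iff)
      have "k \<noteq> 0" using k normal_form_neq[OF b(2)] by auto
      obtain j where j: "v $ j < 0" using kernel_neg_coordinate[OF vker] by blast
      have "0 \<le> - (k * v $ j)" using ki[of j] b_le[of j] j by simp
      then have "0 \<le> k" using j by (simp add: mult_le_0_iff)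
      with \<open>k \<noteq> 0\<close> have "1 \<le> k" by linarith
      have "nat (v $ i) \<le> Poly_Mapping.lookup b i" for i
      proof (cases "0 \<le> v $ i")
        case True
        then have "1 * v $ i \<le> k * v $ i" using \<open>1 \<le> k\<close> by (rule mult_right_mono[rotated])
        then show ?thesis using ki[of i] by simp
      qed simp
      then show ?thesis using b_le by (intro poly_mapping_eqI) (simp add: order_antisym)
    qed
    with nonstd have "pos_part v \<in> leads" by (auto simp: leads_def)
    then show ?thesis
      unfolding gb_def kernel_binomial_def by (rule image_eqI[rotated]) (simp add: nf)
  qed
  consider "weight_le \<omega> (pos_part (- u)) (pos_part u)" | "weight_le \<omega> (pos_part u) (pos_part (- u))"
    using le_total by blast
  then show ?thesis
  proof cases
    case 1
    then show ?thesis using gb_in_universal_groebner_basis[OF monomial_order main[of u]] by simp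
  next
    case 2
    then show ?thesis using gb_in_universal_groebner_basis[OF monomial_order main[of "- u"]]
      by (simp add: kernel_binomial_uminus insert_commute)
  qed
qed

text \<open>As \<open>u\<close> is primitive, a third element \<open>s\<close> of the fibre is not on the segment from \<open>u\<^sup>-\<close> to \<open>u\<^sup>+\<close>.
  Hence a weight supported on one variable of each of \<open>x\<^bsup>u+\<^esup>\<close> and \<open>x\<^bsup>u-\<^esup>\<close> takes a smaller value at \<open>s\<close> than at
  \<open>u\<^sup>+\<close> and \<open>u\<^sup>-\<close>, and neither of these is the normal form of their fibre.\<close>

lemma order_avoiding_binomial:
  assumes u: "u \<in> int_kernel A" "primitive_vec u" and not_thin: "\<not> thin A u"
  obtains le where "monomial_order le"
    "kernel_binomial u \<notin> (pointed_kernel_order.gb A le :: ('n, 'k::field) mpoly set)"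
    "- kernel_binomial u \<notin> (pointed_kernel_order.gb A le :: ('n, 'k) mpoly set)"
proof -
  have u0: "u \<noteq> 0" using u(2) by (rule primitive_vec_neq_0)
  obtain s where s: "adeg A s = adeg A (pos_part u)" "s \<noteq> pos_part u" "s \<noteq> pos_part (- u)"
    using not_thin thin_iff_fibre[OF u(1)] by blast
  let ?s = "\<lambda>i. int (Poly_Mapping.lookup s i)"
  have "\<exists>i j. 0 < u $ i \<and> u $ j < 0 \<and> ?s i * (- u $ j) + ?s j * u $ i < u $ i * (- u $ j)"
  proof (rule ccontr)
    assume "\<not> ?thesis"
    then have ge: "u $ i * (- u $ j) \<le> ?s i * (- u $ j) + ?s j * u $ i" if "0 < u $ i" "u $ j < 0" for i j
      using that by (meson linorder_not_less)
    (* by ge, the vector x - (s_i / u_i) u with x = s - u^- is nonnegative for the least ratio *)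
    let ?P = "{i. 0 < u $ i}" and ?t = "\<lambda>i. real_of_int (?s i) / real_of_int (u $ i)"
    have "finite ?P" "?P \<noteq> {}" using kernel_pos_coordinate[OF u(1) u0] by auto
    then obtain i where i: "i \<in> ?P" "\<And>j. j \<in> ?P \<Longrightarrow> ?t i \<le> ?t j"
      using that arg_min_if_finite(1)[of ?P ?t] arg_min_least[of ?P _ ?t] by blast
    define x where "x = expo_vec s - expo_vec (pos_part (- u))"
    have x: "x \<in> int_kernel A" using s(1) adeg_pos_part[OF u(1)] by (simp add: x_def flip: adeg_eq_iff)
    have "0 \<le> (u $ i *s x - ?s i *s u) $ j" for j
    proof -
      consider "0 < u $ j" | "u $ j = 0" | "u $ j < 0" by linarith
      then show ?thesis
      proof cases
        case 1
        then have "real_of_int (?s i * u $ j) \<le> real_of_int (?s j * u $ i)"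
          using i(2)[of j] i(1) by (simp add: field_simps)
        then have "?s i * u $ j \<le> ?s j * u $ i" by (simp only: of_int_le_iff)
        with 1 show ?thesis by (simp add: x_def mult.commute)
      next
        case 2
        with i(1) show ?thesis by (simp add: x_def)
      next
        case 3
        with ge[of i j] i(1) show ?thesis by (simp add: x_def algebra_simps)
      qed
    qed
    then have "u $ i *s x - ?s i *s u = 0"
      using x u(1) by (intro nonneg_kernel_eq_0 int_kernel_diff int_kernel_scale)
    then have "u $ i *s x = ?s i *s u" by simp
    moreover have "u $ i \<noteq> 0" using i(1) by simp
    ultimately obtain k where "x = k *s u" using primitive_vec_parallel[OF u(2)] by metis
    then have "expo_vec s = expo_vec (pos_part (- u)) + k *s u" by (simp add: x_def algebra_simps)
    then show False using fibre_on_line[OF u(1) u0] s(2,3) by blast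
  qed
  then obtain i j where ij: "0 < u $ i" "u $ j < 0"
    "?s i * (- u $ j) + ?s j * u $ i < u $ i * (- u $ j)" by blast
  (* scaled so that both monomials of the binomial have weight u_i * (- u_j) *)
  define \<omega> :: "'n \<Rightarrow> int" where "\<omega> = (\<lambda>k. (if k = i then - u $ j else 0) + (if k = j then u $ i else 0))"
  have weight: "weight \<omega> t = int (Poly_Mapping.lookup t i) * (- u $ j) + int (Poly_Mapping.lookup t j) * u $ i" for t
    by (simp add: weight_def \<omega>_def distrib_right sum.distrib if_distrib[of "\<lambda>x. x * _"] cong: if_cong)
  interpret pointed_kernel_order A "weight_le \<omega>"
    by unfold_locales (use ij in \<open>simp add: monomial_order_weight_le \<omega>_def\<close>)
  have "weight_le \<omega> (normal_form s) s" by (rule normal_form_le)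
  then have "weight \<omega> (normal_form s) \<le> weight \<omega> s" by (auto simp: weight_le_def)
  also have "weight \<omega> s < u $ i * (- u $ j)" using ij(3) by (simp add: weight)
  finally have "normal_form s \<noteq> pos_part u" "normal_form s \<noteq> pos_part (- u)"
    using ij(1,2) by (auto simp: weight)
  moreover have "normal_form s = normal_form (pos_part u)" "normal_form s = normal_form (pos_part (- u))"
    using s(1) adeg_pos_part[OF u(1)] by (simp_all add: normal_form_def)
  ultimately have nf: "normal_form (pos_part v) \<noteq> pos_part (- v)" if "v = u \<or> v = - u" for v
    using that by auto
  have "kernel_binomial v \<notin> (gb :: ('n, 'k) mpoly set)" if v: "v = u \<or> v = - u" for v
  proof
    assume "kernel_binomial v \<in> (gb :: ('n, 'k) mpoly set)"
    then obtain a where a: "a \<in> leads" "kernel_binomial v = (monom a - monom (normal_form a) :: ('n, 'k) mpoly)"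
      by (auto simp: gb_def)
    have "Poly_Mapping.keys (monom a - monom (normal_form a) :: ('n, 'k) mpoly) = {a, normal_form a}"
      using leads_normal_form_neq[OF a(1)] by (intro keys_binomial) simp
    moreover have "v \<noteq> 0" using v u0 by auto
    ultimately have "{a, normal_form a} = {pos_part v, pos_part (- v)}"
      using keys_kernel_binomial[of v, where ?'k = 'k] a(2) by simp
    then have "a = pos_part v \<and> normal_form a = pos_part (- v) \<or> a = pos_part (- v) \<and> normal_form a = pos_part v"
      by (simp add: doubleton_eq_iff)
    then have "normal_form (pos_part v) = pos_part (- v) \<or> normal_form (pos_part (- v)) = pos_part (- (- v))"
      by auto
    moreover have "- v = u \<or> - v = - u" using v by auto
    ultimately show False using nf v by blast
  qed
  from this[of u] this[of "- u"] show ?thesis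
    by (intro that[OF monomial_order]) (auto simp: kernel_binomial_uminus)
qed

end


section \<open>Robustness\<close>

context pointed_kernel
begin

text \<open>If the fibre of a circuit had a third element, some reduced Groebner basis would avoid its
  binomial. As that basis generates the ideal, the binomial could be omitted from the universal
  Groebner basis, to which it belongs.\<close>

lemma robust_imp_thin:
  assumes robust: "robust (toric_ideal A :: ('n, 'k::field) mpoly set)" and u: "circuit_vec A u"
  shows "thin A u"
proof (rule ccontr)
  let ?f = "kernel_binomial u :: ('n, 'k) mpoly" and ?I = "toric_ideal A :: ('n, 'k) mpoly set"
  let ?C = "universal_groebner_basis ?I - {{?f, - ?f}}"
  assume "\<not> thin A u"
  then obtain le where le: "monomial_order le"
    "?f \<notin> pointed_kernel_order.gb A le" "- ?f \<notin> pointed_kernel_order.gb A le"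
    using order_avoiding_binomial[OF circuit_vecD(1,2)[OF u], where ?'k = 'k] by metis
  interpret pointed_kernel_order A le by unfold_locales fact
  have "gb \<subseteq> \<Union> ?C"
  proof
    fix g :: "('n, 'k) mpoly" assume g: "g \<in> gb"
    then have "g \<noteq> ?f" "g \<noteq> - ?f" using le by auto
    then have "{g, - g} \<in> ?C" using gb_in_universal_groebner_basis[OF le(1) g] by auto
    then show "g \<in> \<Union> ?C" by blast
  qed
  then have "?I \<subseteq> ideal_gen (\<Union> ?C)"
    using ideal_gen_mono ideal_gen_gb by metis
  moreover have "ideal_gen (\<Union> ?C) \<subseteq> ideal_gen (\<Union> (universal_groebner_basis ?I))"
    by (intro ideal_gen_mono) auto
  then have "ideal_gen (\<Union> ?C) \<subseteq> ?I" using robust by (simp add: robust_def)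
  moreover have "?C \<subset> universal_groebner_basis ?I"
    using circuit_in_universal_groebner_basis[OF u] by blast
  ultimately show False using robust unfolding robust_def by blast
qed

text \<open>Binomials with two-element fibres belong to every binomial system of generators, so none of the
  classes can be omitted.\<close>

lemma robust_if_graver_thin:
  assumes thin: "\<And>u. graver A u \<Longrightarrow> thin A u"
  shows "robust (toric_ideal A :: ('n, 'k::field) mpoly set)"
proof -
  let ?I = "toric_ideal A :: ('n, 'k) mpoly set"
  let ?U = "universal_groebner_basis ?I"
  have mo: "monomial_order (weight_le (\<lambda>_ :: 'n. 0))" by (simp add: monomial_order_weight_le)
  interpret pointed_kernel_order A "weight_le (\<lambda>_. 0)" by unfold_locales (rule mo)
  have "gb \<subseteq> \<Union> ?U" using gb_in_universal_groebner_basis[OF mo] by blast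
  then have "?I \<subseteq> ideal_gen (\<Union> ?U)" using ideal_gen_mono ideal_gen_gb by metis
  moreover have "ideal_gen (\<Union> ?U) \<subseteq> ideal_gen ?I"
    by (rule ideal_gen_mono) (rule Union_universal_groebner_basis_subset)
  moreover have "ideal_gen ?I = ?I"
    using ideal_gen_subset[of ?I "kernel_binomial ` int_kernel A"] ideal_gen_base
    unfolding toric_ideal_def by blast
  ultimately have "ideal_gen (\<Union> ?U) = ?I" by blast
  moreover have "ideal_gen (\<Union> C) \<noteq> ?I" if C: "C \<subset> ?U" for C
  proof
    assume gen: "ideal_gen (\<Union> C) = ?I"
    obtain D where D: "D \<in> ?U" "D \<notin> C" using C by blast
    obtain u where u: "graver A u" "D = {kernel_binomial u, - kernel_binomial u}"
      using universal_groebner_basis_graver[OF D(1)] .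
    have uk: "u \<in> int_kernel A" "u \<noteq> 0" using u(1) by (auto simp: graver_def)
    have bin: "is_binomial g" if "g \<in> \<Union> C" for g
    proof -
      obtain E where "E \<in> ?U" "g \<in> E" using \<open>g \<in> \<Union> C\<close> C by blast
      then obtain v where "graver A v" "g = kernel_binomial v \<or> g = kernel_binomial (- v)"
        by (metis universal_groebner_basis_graver insertE kernel_binomial_uminus singletonD)
      then show ?thesis by (auto simp: graver_def intro!: is_binomial_kernel_binomial)
    qed
    have sub: "\<Union> C \<subseteq> ?I" unfolding gen[symmetric] by (auto intro: ideal_gen_base)
    have "kernel_binomial u \<in> ideal_gen (\<Union> C)"
      using uk by (simp add: gen kernel_binomial_in_toric_ideal)
    then have "kernel_binomial u \<in> \<Union> C \<or> - kernel_binomial u \<in> \<Union> C"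
      by (intro thin_in_generating_set[OF uk thin[OF u(1)] sub bin])
    then obtain E where E: "E \<in> C" "kernel_binomial u \<in> E \<or> - kernel_binomial u \<in> E" by blast
    then have "E \<in> ?U" using C by blast
    then obtain v where "E = {kernel_binomial v, - kernel_binomial v}"
      by (rule universal_groebner_basis_graver)
    with E(2) \<open>E = {kernel_binomial v, - kernel_binomial v}\<close>
    have "kernel_binomial u = (kernel_binomial v :: ('n, 'k) mpoly) \<or>
        kernel_binomial u = - (kernel_binomial v :: ('n, 'k) mpoly)"
      by (metis insertE minus_minus singletonD)
    with \<open>E = {kernel_binomial v, - kernel_binomial v}\<close> have "E = D" by (auto simp: u(2))
    with E(1) D(2) show False by simp
  qed
  ultimately show ?thesis unfolding robust_def by blast
qed

end

theorem corollary4p6: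
  fixes A :: "int ^ 'n::finite ^ 'm::finite"
  assumes "int_kernel A \<inter> {u. \<forall>i. 0 \<le> u $ i} = {0}"
    and "rank (map_matrix real_of_int A) + 2 = CARD('n)"
  shows "(\<forall>f \<in> circuits A. indispensable (toric_ideal A) (f :: ('n, 'k::field) mpoly))
         \<longleftrightarrow> robust (toric_ideal A :: ('n, 'k) mpoly set)"
proof -
  interpret pointed_kernel A by unfold_locales (rule assms(1))
  have "(\<forall>f \<in> circuits A. indispensable (toric_ideal A) (f :: ('n, 'k) mpoly))
      \<longleftrightarrow> (\<forall>u. circuit_vec A u \<longrightarrow> thin A u)"
    using indispensable_iff_thin[where ?'k = 'k] circuit_vecD(1,3) unfolding circuits_eq by blast
  also have "\<dots> \<longleftrightarrow> robust (toric_ideal A :: ('n, 'k) mpoly set)"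
  proof
    assume thin: "\<forall>u. circuit_vec A u \<longrightarrow> thin A u"
    show "robust (toric_ideal A :: ('n, 'k) mpoly set)"
    proof (rule robust_if_graver_thin)
      fix z assume z: "graver A z"
      show "thin A z"
      proof (cases "circuit_vec A z")
        case False
        obtain a b k l and \<alpha> \<beta> :: real where ab: "circuit_vec A a" "circuit_vec A b"
          "sign_compatible z a" "sign_compatible z b" "minor k l a b \<noteq> 0" "0 \<le> \<alpha>" "0 \<le> \<beta>"
          "\<And>i. real_of_int (z $ i) = \<alpha> * a $ i + \<beta> * b $ i"
          using graver_circuit_comb[OF assms(2) z False] by metis
        note ker = circuit_vecD(1)[OF ab(1)] circuit_vecD(1)[OF ab(2)]
        show ?thesis
          by (rule thin_comb[OF z rank_two_kernel_span[OF assms(2) ker _ ab(5)] ker ab(3,4) _ _ ab(5-7)])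
            (use thin ab in auto)
      qed (use thin in auto)
    qed
  qed (use robust_imp_thin in auto)
  finally show ?thesis .
qed

end
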